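(* Let $m,n\geq1$. For any $A\in M_{m,n}(\mathbb{R})$, \[ \dim_H\big(\mathbb{R}^m\setminus\mathbf{Bad}_A(\infty)\big)\leq m-\frac{\widehat{w}({}^tA)-\frac{m}{n}}{\widehat{w}({}^tA)+1}. \] In particular, if $A$ is very singular (equivalently, ${}^tA$ is very singular), then $\mathbb{R}^m\setminus\mathbf{Bad}_A(\infty)$ does not have full Hausdorff dimension $m$.
   Context: For $\mathbf{x}\in\mathbb{R}^k$, $\|\mathbf{x}\|=\max_i|x_i|$ and $\|\mathbf{x}\|_{\mathbb{Z}}=\min_{\mathbf{n}\in\mathbb{Z}^k}\|\mathbf{x}-\mathbf{n}\|$. $\mathbf{Bad}_A(\infty)$ is the set of $\mathbf{b}\in\mathbb{R}^m$ with $\liminf_{\mathbf{q}\in\mathbb{Z}^n,\|\mathbf{q}\|\to\infty}\|\mathbf{q}\|^{n/m}\|A\mathbf{q}-\mathbf{b}\|_{\mathbb{Z}}=\infty$. For $B\in M_{k,l}(\mathbb{R})$, $\widehat{w}(B)\in[0,\infty]$ is the supremum of real $w$ such that for all sufficiently large $X$ the inequalities $\|B\mathbf{q}\|_{\mathbb{Z}}<X^{-w}$ and $0<\|\mathbf{q}\|<X$ have a solution $\mathbf{q}\in\mathbb{Z}^l$; $B$ is very singular if $\widehat{w}(B)>l/k$ (so $A$ very singular means $\widehat{w}(A)>n/m$, and ${}^tA\in M_{n,m}$ very singular means $\widehat{w}({}^tA)>m/n$). When $\widehat{w}({}^tA)=\infty$ the fraction in the bound is understood as its limiting value $1$. *)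

theory Defs
  imports "HOL-Analysis.Analysis"
begin

text \<open>The sup norm on \<open>real ^ 'k\<close> is the library's \<^const>\<open>infnorm\<close>
  (see lemma \<open>infnorm_cart\<close>). A matrix in \<open>M_{k,l}(\<real>)\<close> has type \<open>real ^ 'l ^ 'k\<close>,
  with \<open>k = CARD('k)\<close> rows and \<open>l = CARD('l)\<close> columns.\<close>

definition int_vecs :: "(real ^ 'k) set" where
  "int_vecs = {q. \<forall>i. q $ i \<in> \<int>}"

text \<open>The infimum is a minimum; see \<open>dist_int_attained\<close> below.\<close>

definition dist_int :: "real ^ 'k \<Rightarrow> real" where
  "dist_int x = (INF q\<in>int_vecs. infnorm (x - q))"

definition Bad_inf :: "real ^ 'n ^ 'm \<Rightarrow> (real ^ 'm) set" where
  "Bad_inf A = {b. Liminf (inf (filtercomap infnorm at_top) (principal int_vecs))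
      (\<lambda>q. ereal (infnorm q powr (real CARD('n) / real CARD('m)) * dist_int (A *v q - b))) = \<infinity>}"

definition unif_exponent :: "real ^ 'l ^ 'k \<Rightarrow> ereal" where
  "unif_exponent B = Sup (ereal ` {w. \<forall>\<^sub>F X in at_top. \<exists>q\<in>int_vecs.
      dist_int (B *v q) < X powr (- w) \<and> 0 < infnorm q \<and> infnorm q < X})"

definition very_singular :: "real ^ 'l ^ 'k \<Rightarrow> bool" where
  "very_singular B \<longleftrightarrow> unif_exponent B > ereal (real CARD('l) / real CARD('k))"

text \<open>\<open>diam U ^ s\<close>, with the usual conventions for \<open>s = 0\<close>, where \<open>powr\<close> would give
  \<open>0 powr 0 = 0\<close> for singletons.\<close>

definition diam_pow :: "real \<Rightarrow> 'a::metric_space set \<Rightarrow> real" where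
  "diam_pow s U = (if U = {} then 0 else if s = 0 then 1 else diameter U powr s)"

text \<open>The covering sets are required to be bounded because \<^const>\<open>diameter\<close> is unspecified
  on unbounded sets. Finite covers are included, since the sets \<open>U i\<close> may be empty.\<close>

definition hausdorff_premeasure :: "real \<Rightarrow> real \<Rightarrow> 'a::metric_space set \<Rightarrow> ennreal" where
  "hausdorff_premeasure s \<delta> S = Inf {(\<Sum>i. ennreal (diam_pow s (U i))) | U :: nat \<Rightarrow> 'a set.
      S \<subseteq> (\<Union>i. U i) \<and> (\<forall>i. bounded (U i) \<and> diameter (U i) \<le> \<delta>)}"

definition hausdorff_measure :: "real \<Rightarrow> 'a::metric_space set \<Rightarrow> ennreal" where
  "hausdorff_measure s S = (SUP \<delta>\<in>{0<..}. hausdorff_premeasure s \<delta> S)"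

text \<open>On \<open>real ^ 'm\<close> this uses the Euclidean metric; the sup metric is bi-Lipschitz
  equivalent to it and yields the same dimension. The empty set has dimension 0.\<close>

definition hausdorff_dim :: "'a::metric_space set \<Rightarrow> ereal" where
  "hausdorff_dim S = Inf (ereal ` {s. 0 \<le> s \<and> hausdorff_measure s S = 0})"

lemma dist_int_attained:
  fixes x :: "real ^ 'k"
  shows "\<exists>q\<in>int_vecs. dist_int x = infnorm (x - q)"
proof -
  define r :: "real ^ 'k" where "r = (\<chi> i. of_int (round (x $ i)))"
  have r: "r \<in> int_vecs" by (simp add: int_vecs_def r_def)
  have le: "infnorm (x - r) \<le> infnorm (x - q)" if q: "q \<in> int_vecs" for q
  proof -
    have "\<bar>(x - r) $ i\<bar> \<le> infnorm (x - q)" for i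
    proof -
      obtain z :: int where z: "q $ i = of_int z"
        using q by (auto simp: int_vecs_def elim: Ints_cases)
      have "\<bar>(x - r) $ i\<bar> \<le> \<bar>(x - q) $ i\<bar>"
        using round_diff_minimal[of "x $ i" z] by (simp add: r_def z)
      also have "\<dots> \<le> infnorm (x - q)" by (rule component_le_infnorm_cart)
      finally show ?thesis .
    qed
    then show ?thesis
      unfolding infnorm_cart[of "x - r"] by (intro cSup_least) auto
  qed
  have "dist_int x = infnorm (x - r)"
    unfolding dist_int_def by (rule cInf_eq_minimum) (use r le in auto)
  with r show ?thesis by blast
qed

end

theory Submission
  imports Defs "HOL-Real_Asymp.Real_Asymp"
begin

text \<open>If \<open>y\<close> and \<open>z\<close> are integer vectors with \<open>A\<^sup>T y\<close> close to \<open>z\<close>, then every point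
  \<open>A q\<close> with \<open>q\<close> of moderate size lies, modulo integer vectors, close to one of the hyperplanes
  \<open>y \<bullet> b \<in> \<int>\<close>. Hence the points \<open>b\<close> that are approximated by \<open>A q\<close> with \<open>\<parallel>q\<parallel> \<approx> 2^k = Q\<close> up to
  the distance \<open>r = Q powr (- n/m)\<close> lie in a thin neighbourhood of these hyperplanes. With \<open>y\<close> of
  size at most \<open>Y\<close>, where \<open>Y powr (1 + w) = Q powr (1 + n/m)\<close>, it is covered, up to powers of
  \<open>k\<close>, by \<open>Y r powr (1 - m)\<close> cubes of side \<open>r\<close>. The sum over \<open>k\<close> of \<open>Y r powr (s + 1 - m)\<close> converges for
  \<open>s > m - 1 + (m + n) / (n (1 + w)) = m - (w - m/n) / (w + 1)\<close>.

  For the transference between \<open>A\<close> and its transpose, a small residual \<open>\<xi> = A q - p\<close> is used to find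
  integer vectors \<open>y, z\<close> with \<open>y \<bullet> p = z \<bullet> q\<close> by the pigeonhole principle. The identity
  \<open>(A\<^sup>T y - z) \<bullet> q = y \<bullet> \<xi>\<close> then yields, for free, a bound for one further coordinate: one of
  \<open>A\<^sup>T y - z\<close> if \<open>q\<close> dominates, one of \<open>y\<close> if \<open>\<xi>\<close> dominates.\<close>

subsection \<open>Sup norm and Hausdorff measure\<close>

lemma infnorm_attained:
  fixes x :: "real ^ 'k"
  shows "\<exists>i. infnorm x = \<bar>x $ i\<bar>"
proof -
  have "{\<bar>x $ i\<bar> | i. i \<in> UNIV} = range (\<lambda>i. \<bar>x $ i\<bar>)" by auto
  then have "infnorm x = Max (range (\<lambda>i. \<bar>x $ i\<bar>))"
    unfolding infnorm_cart by (simp add: cSup_eq_Max)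
  moreover have "Max (range (\<lambda>i. \<bar>x $ i\<bar>)) \<in> range (\<lambda>i. \<bar>x $ i\<bar>)"
    by (intro Max_in) auto
  ultimately show ?thesis by (metis (no_types, lifting) imageE)
qed

lemma infnorm_le_cart:
  fixes x :: "real ^ 'k"
  assumes "\<And>i. \<bar>x $ i\<bar> \<le> c"
  shows "infnorm x \<le> c"
  using infnorm_attained[of x] assms by metis

lemma inner_le_card_infnorm:
  fixes x y :: "real ^ 'k"
  assumes "infnorm x \<le> a" "infnorm y \<le> b"
  shows "\<bar>x \<bullet> y\<bar> \<le> real CARD('k) * (a * b)"
proof -
  have c: "\<bar>x $ i\<bar> \<le> a" "\<bar>y $ i\<bar> \<le> b" for i
    using component_le_infnorm_cart[of x i] component_le_infnorm_cart[of y i] assms by linarith+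
  have "\<bar>x \<bullet> y\<bar> \<le> (\<Sum>i\<in>UNIV. \<bar>x $ i * y $ i\<bar>)"
    unfolding inner_vec_def by (simp add: sum_abs)
  also have "\<dots> \<le> (\<Sum>i\<in>(UNIV::'k set). a * b)"
    by (intro sum_mono) (use c in \<open>auto simp: abs_mult intro!: mult_mono order_trans[OF _ c(1)]\<close>)
  finally show ?thesis by simp
qed

lemma hausdorff_dim_le:
  assumes "0 \<le> s" "hausdorff_measure s S = 0"
  shows "hausdorff_dim S \<le> ereal s"
  unfolding hausdorff_dim_def using assms by (intro Inf_lower) auto

lemma diam_pow_le:
  assumes "0 < s" "bounded U" "diameter U \<le> d"
  shows "diam_pow s U \<le> d powr s"
  using assms by (auto simp: diam_pow_def diameter_ge_0 intro!: powr_mono2)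

text \<open>This is the Hausdorff-Cantelli lemma: for every \<open>K\<close> the covers of the
  \<open>E k\<close> with \<open>k \<ge> K\<close> together cover \<open>S\<close>, and their cost
  is at most a tail of a convergent series, hence arbitrarily small.\<close>

lemma hausdorff_measure_limsup_eq_0:
  fixes S :: "'a::metric_space set" and E :: "nat \<Rightarrow> 'a set"
  assumes s: "0 < s"
    and limsup: "\<And>x. x \<in> S \<Longrightarrow> \<exists>\<^sub>\<infinity>k. x \<in> E k"
    and cover: "\<forall>\<^sub>F k in sequentially. \<exists>F. finite F \<and> real (card F) \<le> N k \<and> E k \<subseteq> \<Union>F \<and>
                  (\<forall>U\<in>F. bounded U \<and> diameter U \<le> d k)"
    and d0: "d \<longlonglongrightarrow> 0"
    and summ: "summable (\<lambda>k. N k * d k powr s)"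
  shows "hausdorff_measure s S = 0"
proof -
  have "hausdorff_premeasure s \<delta> S \<le> 0 + ennreal e" if \<delta>: "0 < \<delta>" and e: "0 < e" for \<delta> e
  proof -
    obtain K1 where K1: "\<And>k. k \<ge> K1 \<Longrightarrow> \<exists>F. finite F \<and> real (card F) \<le> N k \<and> E k \<subseteq> \<Union>F \<and>
                  (\<forall>U\<in>F. bounded U \<and> diameter U \<le> d k)"
      using cover unfolding eventually_sequentially by blast
    obtain K2 where K2: "\<And>k. k \<ge> K2 \<Longrightarrow> d k < \<delta>"
      using order_tendstoD(2)[OF d0 \<delta>] unfolding eventually_sequentially by blast
    obtain K3 where K3: "\<And>k. k \<ge> K3 \<Longrightarrow> norm (\<Sum>i. N (i + k) * d (i + k) powr s) < e"
      using suminf_exist_split[OF e summ] by blast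
    define K where "K = Max {K1, K2, K3}"
    have K: "K \<ge> K1" "K \<ge> K2" "K \<ge> K3" by (auto simp: K_def)
    have "\<exists>F. finite F \<and> real (card F) \<le> N (k + K) \<and> E (k + K) \<subseteq> \<Union>F \<and>
                  (\<forall>U\<in>F. bounded U \<and> diameter U \<le> d (k + K))" for k
      using K1[of "k + K"] K by simp
    then obtain F where F: "\<And>k. finite (F k)" "\<And>k. real (card (F k)) \<le> N (k + K)"
        "\<And>k. E (k + K) \<subseteq> \<Union>(F k)" "\<And>k U. U \<in> F k \<Longrightarrow> bounded U \<and> diameter U \<le> d (k + K)"
      by metis
    have "\<exists>h. bij_betw h {0..<card (F k)} (F k)" for k
      using ex_bij_betw_nat_finite F(1) by blast
    then obtain h where h: "\<And>k. bij_betw (h k) {0..<card (F k)} (F k)" by metis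
    \<comment> \<open>The finite families are padded with empty sets, whose \<open>diam_pow\<close>
      is 0, so that all levels together form one sequence through
      \<open>prod_decode\<close>.\<close>
    define V where "V = (\<lambda>(k, i). if i < card (F k) then h k i else {})"
    have Vin: "V (k, i) \<in> F k" if "i < card (F k)" for k i
      using h[of k] that unfolding V_def bij_betw_def by auto
    have Vb: "bounded (V x) \<and> diameter (V x) \<le> \<delta>" for x
    proof (cases x)
      case (Pair k i)
      show ?thesis
      proof (cases "i < card (F k)")
        case True
        then show ?thesis
          using F(4)[OF Vin[OF True]] K2[of "k + K"] K Pair by auto
      next
        case False
        then show ?thesis using Pair \<delta> by (simp add: V_def)
      qed
    qed
    have S: "S \<subseteq> (\<Union>i. V (prod_decode i))"
    proof
      fix x assume "x \<in> S"
      then obtain k where k: "k \<ge> K" "x \<in> E k"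
        using limsup[of x] by (auto simp: INFM_nat_le)
      then have "x \<in> \<Union>(F (k - K))" using F(3)[of "k - K"] by auto
      then obtain U where U: "U \<in> F (k - K)" "x \<in> U" by auto
      then have "U \<in> h (k - K) ` {0..<card (F (k - K))}"
        using bij_betw_imp_surj_on[OF h[of "k - K"]] by simp
      then obtain i where i: "i < card (F (k - K))" "h (k - K) i = U" by auto
      then have "x \<in> V (prod_decode (prod_encode (k - K, i)))" using U by (simp add: V_def)
      then show "x \<in> (\<Union>i. V (prod_decode i))" by blast
    qed
    define g where "g = (\<lambda>x. ennreal (diam_pow s (V x)))"
    have level: "(\<Sum>i. g (k, i)) \<le> ennreal (N (k + K) * d (k + K) powr s)" for k
    proof -
      have "(\<Sum>i. g (k, i)) = (\<Sum>i\<in>{..<card (F k)}. g (k, i))"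
        by (intro suminf_finite) (auto simp: g_def V_def diam_pow_def)
      also have "\<dots> \<le> (\<Sum>i\<in>{..<card (F k)}. ennreal (d (k + K) powr s))"
        unfolding g_def using F(4)[OF Vin] s
        by (intro sum_mono ennreal_leI diam_pow_le) auto
      also have "\<dots> = ennreal (real (card (F k)) * d (k + K) powr s)"
        by (simp add: ennreal_mult' ennreal_of_nat_eq_real_of_nat)
      also have "\<dots> \<le> ennreal (N (k + K) * d (k + K) powr s)"
        using F(2)[of k] by (intro ennreal_leI mult_right_mono) auto
      finally show ?thesis .
    qed
    have nn: "0 \<le> N (k + K) * d (k + K) powr s" for k
      using order_trans[OF of_nat_0_le_iff F(2)] by simp
    have "(\<Sum>i. g (prod_decode i)) = (\<Sum>k. \<Sum>i. g (k, i))"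
      by (rule suminf_ennreal_2dimen) simp
    also have "\<dots> \<le> (\<Sum>k. ennreal (N (k + K) * d (k + K) powr s))"
      by (intro suminf_le level) auto
    also have "\<dots> = ennreal (\<Sum>k. N (k + K) * d (k + K) powr s)"
      using nn summable_ignore_initial_segment[OF summ, of K] by (intro suminf_ennreal2)
    also have "\<dots> \<le> ennreal e" using K3[OF K(3)] by (intro ennreal_leI) auto
    finally have sum: "(\<Sum>i. ennreal (diam_pow s (V (prod_decode i)))) \<le> ennreal e"
      by (simp add: g_def)
    have "hausdorff_premeasure s \<delta> S \<le> (\<Sum>i. ennreal (diam_pow s (V (prod_decode i))))"
      unfolding hausdorff_premeasure_def
      by (intro Inf_lower CollectI exI[of _ "\<lambda>i. V (prod_decode i)"] conjI refl S allI)
        (use Vb in blast)+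
    then show ?thesis using sum by simp
  qed
  note prem = this
  have "hausdorff_premeasure s \<delta> S \<le> 0" if "0 < \<delta>" for \<delta>
    by (rule ennreal_le_epsilon) (rule prem[OF that])
  then show ?thesis unfolding hausdorff_measure_def by (auto intro!: antisym SUP_least)
qed

lemma card_int_interval: "real (card {j::int. \<bar>real_of_int j\<bar> \<le> x}) \<le> 2 * x + 1" if "0 \<le> x"
proof -
  have eq: "\<bar>real_of_int j\<bar> \<le> x \<longleftrightarrow> \<bar>j\<bar> \<le> \<lfloor>x\<rfloor>" for j :: int
    by (simp add: le_floor_iff)
  have "{j::int. \<bar>real_of_int j\<bar> \<le> x} = {-\<lfloor>x\<rfloor>..\<lfloor>x\<rfloor>}"
    unfolding eq by auto
  then have "real (card {j::int. \<bar>real_of_int j\<bar> \<le> x}) = 2 * real_of_int \<lfloor>x\<rfloor> + 1"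
    using that by simp
  then show ?thesis using of_int_floor_le[of x] by linarith
qed

lemma finite_int_interval: "finite {j::int. \<bar>real_of_int j\<bar> \<le> x}"
proof (rule finite_subset)
  show "{j::int. \<bar>real_of_int j\<bar> \<le> x} \<subseteq> {-\<lceil>x\<rceil>..\<lceil>x\<rceil>}"
    by (auto simp: abs_le_iff) linarith+
qed simp

subsection \<open>Covering neighbourhoods of parallel hyperplanes\<close>

lemma diameter_cube_le:
  fixes v :: "real ^ 'k"
  assumes "0 \<le> r"
  shows "diameter (cbox v (v + (\<chi> i. r))) \<le> real CARD('k) * r"
proof (rule diameter_le)
  fix x y assume xy: "x \<in> cbox v (v + (\<chi> i. r))" "y \<in> cbox v (v + (\<chi> i. r))"
  have "\<bar>(x - y) $ i\<bar> \<le> r" for i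
  proof -
    have "v $ i \<le> x $ i \<and> x $ i \<le> v $ i + r" "v $ i \<le> y $ i \<and> y $ i \<le> v $ i + r"
      using xy by (auto simp: mem_box_cart)
    then show ?thesis by auto
  qed
  then have "(\<Sum>i\<in>UNIV. \<bar>(x - y) $ i\<bar>) \<le> (\<Sum>i\<in>(UNIV::'k set). r)" by (intro sum_mono)
  then show "norm (x - y) \<le> real CARD('k) * r"
    using norm_le_l1_cart[of "x - y"] by simp
qed (use assms in auto)

text \<open>Away from a coordinate \<open>i0\<close> at which \<open>\<bar>y $ i\<bar>\<close> is
  maximal, the cells form a grid of side \<open>r\<close>. Once these coordinates and the hyperplane
  are fixed, the slab leaves for the coordinate \<open>i0\<close> an interval whose length is, up to
  constants, \<open>V / L + r\<close>. The three factors in the hypothesis \<open>N\<close> count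
  the grid positions, the cells along direction \<open>i0\<close> and the hyperplanes that can come
  within \<open>V\<close> of the ball.\<close>

lemma slab_cover:
  fixes y :: "real ^ 'm"
  assumes L_eq: "L = infnorm y"
    and pos: "0 < L" "0 < r" "0 \<le> R" "0 \<le> V"
    and E: "E \<subseteq> {b. infnorm b \<le> R \<and> (\<exists>h\<in>\<int>. \<bar>y \<bullet> b - h\<bar> \<le> V)}"
    and N: "(2 * (R / r + 1) + 1) ^ (CARD('m) - 1)
        * ((2 * ((V + real CARD('m) * (L * r)) / (L * r) + 1) + 1)
        * (2 * (real CARD('m) * (L * R) + V) + 1)) \<le> N"
  shows "\<exists>F. finite F \<and> real (card F) \<le> N \<and> E \<subseteq> \<Union>F \<and>
      (\<forall>U\<in>F. bounded U \<and> diameter U \<le> real CARD('m) * r)"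
proof -
  define m where "m = real CARD('m)"
  have m1: "1 \<le> m" unfolding m_def by (simp add: Suc_leI)
  obtain i0 where i0: "L = \<bar>y $ i0\<bar>" unfolding L_eq using infnorm_attained by blast
  have y0: "y $ i0 \<noteq> 0" using pos i0 by auto
  \<comment> \<open>The offset from the hyperplane is at most \<open>T - 1\<close> in units of
    \<open>r\<close>; the added 1 accounts for rounding down.\<close>
  define T where "T = (V + m * (L * r)) / (L * r) + 1"
  define H where "H = m * (L * R) + V"
  have TH: "0 \<le> T" "0 \<le> H" using pos m1 by (auto simp: T_def H_def)
  \<comment> \<open>The entry \<open>i0\<close> is set to 0, so that \<open>g c\<close> does not
    change when \<open>c i0\<close> is chosen afterwards.\<close>
  define g :: "('m \<Rightarrow> int) \<Rightarrow> real ^ 'm" where "g c = (\<chi> i. if i = i0 then 0 else r * of_int (c i))" for c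
  \<comment> \<open>In the direction \<open>i0\<close> the cell is placed relative to the point where the hyperplane
    \<open>y \<bullet> b = h\<close> meets the line through \<open>g c\<close>.\<close>
  define v where "v = (\<lambda>(c, h::int). g c + axis i0 (r * of_int (c i0) + (of_int h - y \<bullet> g c) / y $ i0))"
  define B where "B = (\<lambda>i. {j::int. \<bar>real_of_int j\<bar> \<le> (if i = i0 then T else R / r + 1)})"
  define I where "I = (PiE UNIV B) \<times> {h::int. \<bar>real_of_int h\<bar> \<le> H}"
  define F where "F = (\<lambda>x. cbox (v x) (v x + (\<chi> i. r))) ` I"
  have finI: "finite I"
    unfolding I_def B_def by (intro finite_cartesian_product finite_PiE finite_int_interval) auto
  have "real (card F) \<le> real (card I)"
    unfolding F_def using finI by (simp add: card_image_le)
  also have "\<dots> = (\<Prod>i\<in>UNIV. real (card (B i))) * real (card {h::int. \<bar>real_of_int h\<bar> \<le> H})"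
    unfolding I_def by (simp add: card_cartesian_product card_PiE)
  also have "\<dots> \<le> (\<Prod>i\<in>UNIV. if i = i0 then 2 * T + 1 else 2 * (R / r + 1) + 1) * (2 * H + 1)"
    using TH pos card_int_interval[of T] card_int_interval[of "R / r + 1"] card_int_interval[of H]
    by (intro mult_mono prod_mono prod_nonneg) (auto simp: B_def)
  also have "(\<Prod>i\<in>(UNIV::'m set). if i = i0 then 2 * T + 1 else 2 * (R / r + 1) + 1)
      = (2 * T + 1) * (2 * (R / r + 1) + 1) ^ (CARD('m) - 1)"
    by (subst prod.remove[of _ i0]) (auto simp: card_Diff_singleton)
  finally have card: "real (card F) \<le> (2 * (R / r + 1) + 1) ^ (CARD('m) - 1) * ((2 * T + 1) * (2 * H + 1))"
    by (simp add: mult_ac)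
  have "{b. infnorm b \<le> R \<and> (\<exists>h\<in>\<int>. \<bar>y \<bullet> b - h\<bar> \<le> V)} \<subseteq> \<Union>F"
  proof safe
    fix b :: "real ^ 'm" and h' :: real
    assume bR: "infnorm b \<le> R" and "h' \<in> \<int>" and hV': "\<bar>y \<bullet> b - h'\<bar> \<le> V"
    then obtain h :: int where h': "h' = of_int h" by (auto elim: Ints_cases)
    then have hV: "\<bar>y \<bullet> b - of_int h\<bar> \<le> V" using hV' by simp
    define c0 where "c0 = (\<lambda>i. \<lfloor>b $ i / r\<rfloor>)"
    define \<tau> where "\<tau> = (of_int h - y \<bullet> g c0) / y $ i0"
    \<comment> \<open>Only the index in direction \<open>i0\<close> is changed: it is measured from
      \<open>\<tau>\<close>, where the line through \<open>g c0\<close> in this direction meets the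
      hyperplane.\<close>
    define c where "c = c0(i0 := \<lfloor>(b $ i0 - \<tau>) / r\<rfloor>)"
    have gc: "g c = g c0" by (auto simp: g_def c_def vec_eq_iff)
    have fl: "r * of_int \<lfloor>x / r\<rfloor> \<le> x \<and> x \<le> r * of_int \<lfloor>x / r\<rfloor> + r" for x
    proof -
      define j where "j = \<lfloor>x / r\<rfloor>"
      have "of_int j \<le> x / r" "x / r \<le> of_int j + 1" unfolding j_def by linarith+
      then show ?thesis using pos(2) unfolding j_def[symmetric] by (auto simp: field_simps)
    qed
    have fl2: "\<bar>real_of_int \<lfloor>x\<rfloor>\<bar> \<le> \<bar>x\<bar> + 1" for x :: real by linarith
    \<comment> \<open>\<open>u\<close> is the deviation of \<open>b\<close> from the grid point in
      the coordinates other than \<open>i0\<close>; it shifts \<open>y \<bullet> b\<close> by at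
      most \<open>m * (L * r)\<close>.\<close>
    define u where "u = b - g c0 - axis i0 (b $ i0)"
    have "infnorm u \<le> r"
    proof (rule infnorm_le_cart)
      fix i show "\<bar>u $ i\<bar> \<le> r"
        using fl[of "b $ i"] pos by (auto simp: u_def g_def c0_def axis_def abs_if)
    qed
    then have yu: "\<bar>y \<bullet> u\<bar> \<le> m * (L * r)"
      unfolding m_def L_eq by (intro inner_le_card_infnorm) auto
    have "y \<bullet> u = y \<bullet> b - y \<bullet> g c0 - y $ i0 * b $ i0"
      by (simp add: u_def inner_diff_right inner_axis)
    moreover have "y $ i0 * \<tau> = of_int h - y \<bullet> g c0" using y0 by (simp add: \<tau>_def)
    ultimately have eq: "y $ i0 * (b $ i0 - \<tau>) = (y \<bullet> b - of_int h) - y \<bullet> u"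
      unfolding right_diff_distrib by linarith
    have "L * \<bar>b $ i0 - \<tau>\<bar> = \<bar>y $ i0 * (b $ i0 - \<tau>)\<bar>" by (simp add: i0 abs_mult)
    also have "\<dots> \<le> V + m * (L * r)" unfolding eq using hV yu by linarith
    finally have "\<bar>b $ i0 - \<tau>\<bar> \<le> (V + m * (L * r)) / L"
      using pos(1) by (simp add: pos_le_divide_eq mult.commute)
    then have "\<bar>b $ i0 - \<tau>\<bar> / r \<le> (V + m * (L * r)) / L / r"
      by (intro divide_right_mono) (use pos(2) in auto)
    then have "\<bar>b $ i0 - \<tau>\<bar> / r \<le> (V + m * (L * r)) / (L * r)" by simp
    then have "\<bar>(b $ i0 - \<tau>) / r\<bar> \<le> T - 1"
      using pos by (simp add: T_def abs_divide)
    then have cT: "\<bar>real_of_int (c i0)\<bar> \<le> T" using fl2[of "(b $ i0 - \<tau>) / r"] unfolding c_def fun_upd_same by linarith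
    have cR: "\<bar>real_of_int (c i)\<bar> \<le> R / r + 1" if "i \<noteq> i0" for i
    proof -
      have "\<bar>b $ i\<bar> \<le> R" using component_le_infnorm_cart[of b i] bR by linarith
      then have "\<bar>b $ i / r\<bar> \<le> R / r" using pos by (simp add: abs_divide divide_right_mono)
      moreover have "c i = \<lfloor>b $ i / r\<rfloor>" using that by (simp add: c_def c0_def)
      ultimately show ?thesis using fl2[of "b $ i / r"] by linarith
    qed
    have "\<bar>y \<bullet> b\<bar> \<le> m * (L * R)"
      unfolding m_def L_eq by (intro inner_le_card_infnorm bR) auto
    then have "\<bar>real_of_int h\<bar> \<le> H" using hV by (simp add: H_def)
    then have I: "(c, h) \<in> I" using cT cR by (auto simp: I_def B_def)
    have "v (c, h) $ i \<le> b $ i \<and> b $ i \<le> v (c, h) $ i + r" for i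
    proof (cases "i = i0")
      case True
      then have "v (c, h) $ i = r * of_int \<lfloor>(b $ i0 - \<tau>) / r\<rfloor> + \<tau>"
        by (simp add: v_def gc, simp add: \<tau>_def c_def g_def)
      then show ?thesis using True fl[of "b $ i0 - \<tau>"] by auto
    next
      case False
      then have "v (c, h) $ i = r * of_int \<lfloor>b $ i / r\<rfloor>"
        by (simp add: v_def gc, simp add: g_def c0_def axis_def)
      then show ?thesis using fl[of "b $ i"] by auto
    qed
    then have "b \<in> cbox (v (c, h)) (v (c, h) + (\<chi> i. r))" by (auto simp: mem_box_cart)
    then show "b \<in> \<Union>F" unfolding F_def using I by blast
  qed
  moreover have "\<forall>U\<in>F. bounded U \<and> diameter U \<le> m * r"
    unfolding F_def m_def using diameter_cube_le[where 'k = 'm, OF less_imp_le[OF pos(2)]]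
    by (simp add: bounded_cbox)
  moreover have "finite F" unfolding F_def using finI by blast
  ultimately show ?thesis
    using order_trans[OF card, of N] N order_trans[OF E] unfolding T_def H_def m_def by blast
qed

section \<open>Integer vectors, points outside \<open>Bad_inf A\<close>, and dyadic scales\<close>

lemma infnorm_int_vec_ge_1:
  fixes y :: "real ^ 'k"
  assumes "y \<in> int_vecs" "0 < infnorm y"
  shows "1 \<le> infnorm y"
proof -
  obtain i where i: "infnorm y = \<bar>y $ i\<bar>" using infnorm_attained by blast
  have "y $ i \<in> \<int>" using assms by (simp add: int_vecs_def)
  then show ?thesis using assms i Ints_nonzero_abs_ge1[of "y $ i"] by auto
qed

lemma inner_int_vecs:
  fixes x y :: "real ^ 'k"
  assumes "x \<in> int_vecs" "y \<in> int_vecs"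
  shows "x \<bullet> y \<in> \<int>"
  using assms unfolding inner_vec_def int_vecs_def by (auto intro!: Ints_sum Ints_mult)

lemma inner_transpose:
  fixes A :: "real ^ 'n ^ 'm"
  shows "y \<bullet> (A *v q) = (transpose A *v y) \<bullet> q"
  by (simp add: transpose_matrix_vector dot_lmul_matrix)

text \<open>If the liminf is not \<open>\<infinity>\<close>, some level below
  \<open>\<infinity>\<close> is not eventually exceeded, and it can be raised to a real number. The
  constant \<open>c\<close> depends on \<open>b\<close>.\<close>

lemma not_Bad_inf_frequently:
  fixes A :: "real ^ 'n ^ 'm"
  assumes "b \<notin> Bad_inf A"
  shows "\<exists>c::real. \<forall>N. \<exists>q\<in>int_vecs. N \<le> infnorm q \<and>
    infnorm q powr (real CARD('n) / real CARD('m)) * dist_int (A *v q - b) \<le> c"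
proof -
  define f where "f q = infnorm q powr (real CARD('n) / real CARD('m)) * dist_int (A *v q - b)"
    for q :: "real ^ 'n"
  define F where "F = inf (filtercomap infnorm at_top) (principal (int_vecs :: (real ^ 'n) set))"
  have "Liminf F (\<lambda>q. ereal (f q)) \<noteq> \<infinity>"
    using assms unfolding Bad_inf_def F_def f_def by simp
  then obtain e where e: "e < \<infinity>" "\<not> eventually (\<lambda>q. e < ereal (f q)) F"
    using le_Liminf_iff[of "\<infinity>" F "\<lambda>q. ereal (f q)"] by auto
  obtain c where c: "e \<le> ereal c"
    using e(1) by (cases e) (auto intro: that)
  have "\<not> eventually (\<lambda>q. ereal c < ereal (f q)) F"
    using e(2) c by (metis (mono_tags, lifting) eventually_mono order_le_less_trans)
  then have "\<exists>q\<in>int_vecs. N \<le> infnorm q \<and> f q \<le> c" for N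
    unfolding F_def eventually_inf_principal eventually_filtercomap_at_top_linorder
    by (auto simp: not_less)
  then show ?thesis unfolding f_def by blast
qed

text \<open>The powers of \<open>k\<close> arise because bounds such as the radius of the ball grow
  with \<open>k\<close>; exponential decay absorbs them.\<close>

lemma summable_power_times_exp:
  assumes "0 < \<gamma>"
  shows "summable (\<lambda>k. real k ^ p * 2 powr (- \<gamma> * real k))"
proof (rule summable_comparison_test_bigo)
  show "summable (\<lambda>k. norm (1 / real k ^ 2))"
    using inverse_power_summable[of 2, where 'a = real] by (simp add: inverse_eq_divide)
  show "(\<lambda>k. real k ^ p * 2 powr (- \<gamma> * real k)) \<in> O(\<lambda>k. 1 / real k ^ 2)"
    using assms by real_asymp
qed

lemma exists_dyadic_scale:
  fixes x :: real
  assumes "1 \<le> x"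
  shows "\<exists>k. 2 ^ k \<le> x \<and> x < 2 ^ Suc k"
proof -
  define k where "k = nat \<lfloor>log 2 x\<rfloor>"
  have "0 \<le> log 2 x" using assms by simp
  then have k: "real k \<le> log 2 x" "log 2 x < real (Suc k)" unfolding k_def by linarith+
  have "2 powr real k \<le> x" using k(1) assms by (simp add: le_log_iff)
  moreover have "x < 2 powr real (Suc k)" using k(2) assms by (simp add: log_less_iff)
  ultimately show ?thesis by (auto simp only: powr_realpow[of 2, simplified])
qed

text \<open>With \<open>y\<close> a unit vector and \<open>V = 1\<close> the slabs fill the whole
  space, so \<open>slab_cover\<close> covers the ball of radius \<open>k\<close> by a constant times
  \<open>(k / r) ^ m\<close> cubes of side \<open>r\<close>. This supplies the trivial bound on the
  dimension.\<close>

lemma hausdorff_measure_eq_0_above_dim: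
  fixes S :: "(real ^ 'm) set"
  assumes s: "real CARD('m) < s"
  shows "hausdorff_measure s S = 0"
proof -
  define m where "m = real CARD('m)"
  have m1: "1 \<le> m" unfolding m_def by (simp add: Suc_leI)
  define r where "r k = 2 powr (- real k)" for k
  have r0: "0 < r k" "r k \<le> 1" for k
    using powr_mono[of "- real k" 0 2] by (auto simp: r_def)
  define N where "N k = (5 * real k / r k) ^ (CARD('m) - 1) * (((2 * m + 5) / r k) * ((2 * m + 3) * real k))" for k
  define d where "d k = m * r k" for k
  define C where "C = 5 ^ (CARD('m) - 1) * (2 * m + 5) * (2 * m + 3) * m powr s"
  have Nd: "N k * d k powr s = C * (real k ^ CARD('m) * 2 powr (- (s - m) * real k))" for k
  proof -
    have a: "real k ^ CARD('m) = real k ^ (CARD('m) - 1) * real k"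
      by (metis One_nat_def Suc_pred mult.commute power_Suc zero_less_card_finite)
    have "2 powr (- (s - m) * real k) = r k powr s / r k ^ CARD('m)"
      by (simp add: r_def powr_powr flip: powr_realpow powr_diff) (simp add: m_def algebra_simps)
    also have "r k ^ CARD('m) = r k ^ (CARD('m) - 1) * r k"
      by (metis One_nat_def Suc_pred mult.commute power_Suc zero_less_card_finite)
    finally have b: "2 powr (- (s - m) * real k) = r k powr s / (r k ^ (CARD('m) - 1) * r k)" .
    show ?thesis
      unfolding a b N_def d_def C_def using r0[of k] m1
      by (simp add: powr_mult power_mult_distrib power_divide)
  qed
  show ?thesis
  proof (rule hausdorff_measure_limsup_eq_0[where E = "\<lambda>k. {b. infnorm b \<le> real k}" and N = N and d = d])
    show "0 < s" using s m1 unfolding m_def by linarith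
    show "\<exists>\<^sub>\<infinity>k. b \<in> {b. infnorm b \<le> real k}" for b :: "real ^ 'm"
      unfolding INFM_nat_le
    proof
      fix K show "\<exists>k\<ge>K. b \<in> {b. infnorm b \<le> real k}"
        using real_nat_ceiling_ge[of "infnorm b"]
        by (intro exI[of _ "max K (nat \<lceil>infnorm b\<rceil>)"]) auto
    qed
    show "d \<longlonglongrightarrow> 0" unfolding d_def r_def by real_asymp
    show "summable (\<lambda>k. N k * d k powr s)"
      unfolding Nd using s by (intro summable_mult summable_power_times_exp) (auto simp: m_def)
    have cov: "\<exists>F. finite F \<and> real (card F) \<le> N k \<and> {b :: real ^ 'm. infnorm b \<le> real k} \<subseteq> \<Union>F \<and>
        (\<forall>U\<in>F. bounded U \<and> diameter U \<le> d k)" if k: "1 \<le> k" for k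
    proof -
      obtain i :: 'm where True by simp
      define y :: "real ^ 'm" where "y = axis i 1"
      have L: "infnorm y = 1"
      proof (rule antisym)
        show "infnorm y \<le> 1" by (rule infnorm_le_cart) (simp add: y_def axis_def)
        show "1 \<le> infnorm y" using component_le_infnorm_cart[of y i] by (simp add: y_def)
      qed
      have sub: "{b :: real ^ 'm. infnorm b \<le> real k} \<subseteq> {b. infnorm b \<le> real k \<and> (\<exists>h\<in>\<int>. \<bar>y \<bullet> b - h\<bar> \<le> 1)}"
      proof safe
        fix b :: "real ^ 'm"
        have "\<bar>y \<bullet> b - of_int \<lfloor>y \<bullet> b\<rfloor>\<bar> \<le> 1" by linarith
        then show "\<exists>h\<in>\<int>. \<bar>y \<bullet> b - h\<bar> \<le> 1" by (intro bexI[of _ "of_int \<lfloor>y \<bullet> b\<rfloor>"]) auto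
      qed
      have rk: "1 \<le> 1 / r k" using r0[of k] by simp
      have "1 * 1 \<le> real k * (1 / r k)" using k rk by (intro mult_mono) auto
      then have k1: "1 \<le> real k / r k" by simp
      have lin: "2 * (x + 1) + 1 \<le> 5 * x" if "1 \<le> x" for x :: real using that by simp
      have "(2 * (real k / r k + 1) + 1) ^ (CARD('m) - 1)
          * ((2 * ((1 + m * (1 * r k)) / (1 * r k) + 1) + 1) * (2 * (m * (1 * real k) + 1) + 1)) \<le> N k"
        unfolding N_def
      proof (intro mult_mono power_mono)
        show "2 * (real k / r k + 1) + 1 \<le> 5 * real k / r k"
          using lin[OF k1] by simp
        define t where "t = 1 / r k"
        have "m * 1 \<le> m * t" unfolding t_def using m1 rk by (intro mult_left_mono) auto
        then have "2 * (t + m + 1) + 1 \<le> 2 * (m * t) + 5 * t" using rk unfolding t_def[symmetric] by simp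
        moreover have "(1 + m * (1 * r k)) / (1 * r k) = t + m"
          using r0[of k] by (simp add: t_def field_simps)
        moreover have "(2 * m + 5) / r k = 2 * (m * t) + 5 * t" by (simp add: t_def add_divide_distrib)
        ultimately show "2 * ((1 + m * (1 * r k)) / (1 * r k) + 1) + 1 \<le> (2 * m + 5) / r k" by simp
        show "2 * (m * (1 * real k) + 1) + 1 \<le> (2 * m + 3) * real k"
          using k by (simp add: algebra_simps)
      qed (use r0[of k] m1 in auto)
      then show ?thesis
        unfolding d_def m_def
        by (intro slab_cover[where y = y and L = 1 and r = "r k" and R = "real k" and V = 1] sub)
          (use r0[of k] L in auto)
    qed
    show "\<forall>\<^sub>F k in sequentially. \<exists>F. finite F \<and> real (card F) \<le> N k \<and> {b :: real ^ 'm. infnorm b \<le> real k} \<subseteq> \<Union>F \<and>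
        (\<forall>U\<in>F. bounded U \<and> diameter U \<le> d k)"
      by (rule eventually_sequentiallyI[of 1]) (rule cov)
  qed
qed

subsection \<open>Covering the complement of \<open>Bad_inf A\<close>\<close>

text \<open>The integer is \<open>h = z \<bullet> q - y \<bullet> p\<close>, where \<open>z\<close>
  and \<open>p\<close> are integer vectors nearest to \<open>transpose A *v y\<close> and
  \<open>A *v q - b\<close>. Moving \<open>A\<close> across the inner product leaves only the two
  approximation errors.\<close>

lemma slab_of_approximation:
  fixes A :: "real ^ 'n ^ 'm"
  assumes q: "q \<in> int_vecs" "infnorm q \<le> Q" and y: "y \<in> int_vecs" "infnorm y \<le> Y"
    and t: "dist_int (transpose A *v y) \<le> \<epsilon>" and d: "dist_int (A *v q - b) \<le> \<delta>"
  shows "\<exists>h\<in>\<int>. \<bar>y \<bullet> b - h\<bar> \<le> real CARD('n) * (\<epsilon> * Q) + real CARD('m) * (Y * \<delta>)"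
proof -
  obtain p where p: "p \<in> int_vecs" "dist_int (A *v q - b) = infnorm (A *v q - b - p)"
    using dist_int_attained by blast
  obtain z where z: "z \<in> int_vecs" "dist_int (transpose A *v y) = infnorm (transpose A *v y - z)"
    using dist_int_attained by blast
  have "y \<bullet> b - (z \<bullet> q - y \<bullet> p) = (transpose A *v y - z) \<bullet> q - y \<bullet> (A *v q - b - p)"
    by (simp add: inner_diff_right inner_diff_left inner_transpose)
  moreover have "\<bar>(transpose A *v y - z) \<bullet> q\<bar> \<le> real CARD('n) * (\<epsilon> * Q)"
    using z t q by (intro inner_le_card_infnorm) auto
  moreover have "\<bar>y \<bullet> (A *v q - b - p)\<bar> \<le> real CARD('m) * (Y * \<delta>)"
    using p d y by (intro inner_le_card_infnorm) auto
  ultimately have "\<bar>y \<bullet> b - (z \<bullet> q - y \<bullet> p)\<bar> \<le> real CARD('n) * (\<epsilon> * Q) + real CARD('m) * (Y * \<delta>)"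
    by linarith
  moreover have "z \<bullet> q - y \<bullet> p \<in> \<int>"
    using z p q y by (intro Ints_diff inner_int_vecs)
  ultimately show ?thesis by blast
qed

text \<open>The Cantelli argument is applied to the pieces \<open>E k\<close> at dyadic scale
  \<open>2 ^ k\<close>; for large \<open>k\<close> each piece lies in the slabs of a single dual
  vector \<open>y\<close> and is counted by \<open>slab_cover\<close>.\<close>

lemma hausdorff_measure_compl_Bad_inf_eq_0:
  fixes A :: "real ^ 'n ^ 'm"
  defines "n \<equiv> real CARD('n)" and "m \<equiv> real CARD('m)"
  assumes ev: "\<forall>\<^sub>F X in at_top. \<exists>y\<in>int_vecs.
      dist_int (transpose A *v y) < X powr (- w) \<and> 0 < infnorm y \<and> infnorm y < X"
    and w: "m / n \<le> w" and s: "m - 1 + (m + n) / (n * (1 + w)) < s"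
  shows "hausdorff_measure s (- Bad_inf A) = 0"
proof -
  have m1: "1 \<le> m" and n1: "1 \<le> n" unfolding m_def n_def by (simp_all add: Suc_leI)
  have "0 < m / n" using m1 n1 by simp
  then have w0: "0 < w" using w by linarith
  have mnw: "m \<le> w * n" using w n1 by (simp add: pos_divide_le_eq)
  define D where "D = 2 * n + m"
  \<comment> \<open>This exponent gives \<open>Y k powr (1 + w) = 2 powr ((1 + n / m) * k)\<close>,
    which makes both error terms of \<open>slab_of_approximation\<close> equal to
    \<open>Y k * r k\<close> up to constants and a factor \<open>k\<close>.\<close>
  define \<beta> where "\<beta> = (m + n) / (m * (1 + w))"
  define r where "r k = 2 powr (- (n / m) * real k)" for k
  define Y where "Y k = 2 powr (\<beta> * real k)" for k
  have \<beta>0: "0 < \<beta>" unfolding \<beta>_def using m1 n1 w0 by simp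
  have "\<beta> * (1 + w) = (m + n) / m" using w0 unfolding \<beta>_def by simp
  then have \<beta>1: "\<beta> * (1 + w) = 1 + n / m" using m1 by (simp add: add_divide_distrib)
  have "m * (n * (1 + w)) \<ge> m * (m + n)"
    using mnw m1 by (intro mult_left_mono) (auto simp: algebra_simps)
  then have \<beta>2: "\<beta> \<le> n / m"
    using m1 w0 unfolding \<beta>_def by (simp add: divide_simps mult_ac)
  have r0: "0 < r k" "r k \<le> 1" for k
    using powr_mono[of "- (n / m) * real k" 0 2] m1 n1 by (auto simp: r_def)
  have Y1: "1 \<le> Y k" for k
    using powr_mono[of 0 "\<beta> * real k" 2] \<beta>0 by (auto simp: Y_def)
  have Yr1: "Y k * r k \<le> 1" for k
  proof -
    have "Y k * r k = 2 powr ((\<beta> - n / m) * real k)"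
      by (simp add: Y_def r_def algebra_simps flip: powr_add)
    also have "\<dots> \<le> 2 powr 0" using \<beta>2 by (intro powr_mono mult_nonpos_nonneg) auto
    finally show ?thesis by simp
  qed
  have Yw: "2 ^ k * Y k powr (- w) = Y k * r k" for k
  proof -
    have "2 ^ k * Y k powr (- w) = 2 powr (real k * (1 - \<beta> * w))"
      by (simp add: Y_def powr_powr algebra_simps flip: powr_realpow powr_add)
    also have "1 - \<beta> * w = \<beta> - n / m" using \<beta>1 by (simp add: algebra_simps)
    also have "2 powr (real k * (\<beta> - n / m)) = Y k * r k"
      by (simp add: Y_def r_def algebra_simps flip: powr_add)
    finally show ?thesis .
  qed
  \<comment> \<open>The radius and the approximation constant both grow with \<open>k\<close>, so
    that any fixed bounds are eventually met; this costs only powers of \<open>k\<close>.\<close>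
  define E where "E k = {b :: real ^ 'm. infnorm b \<le> real k \<and> (\<exists>q\<in>int_vecs. 2 ^ k \<le> infnorm q \<and>
      infnorm q < 2 ^ Suc k \<and> infnorm q powr (n / m) * dist_int (A *v q - b) \<le> real k)}" for k
  define c1 c2 where "c1 = 2 * D + 2 * m + 3" and "c2 = 2 * m + 2 * D + 1"
  \<comment> \<open>The count along direction \<open>i0\<close> carries a factor
    \<open>1 / L\<close> and the count of hyperplanes a factor \<open>L\<close>; in their product
    the size of \<open>y\<close> cancels.\<close>
  define N where "N k = (5 * real k / r k) ^ (CARD('m) - 1) * ((c1 * real k * Y k) * (c2 * real k))" for k
  define d where "d k = m * r k" for k
  define C where "C = 5 ^ (CARD('m) - 1) * c1 * c2 * m powr s"
  \<comment> \<open>Up to powers of \<open>k\<close>, this is the decay rate of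
    \<open>N k * d k powr s\<close>; it is positive exactly when
    \<open>s > m - 1 + (m + n) / (n * (1 + w))\<close>.\<close>
  define \<gamma> where "\<gamma> = n / m * (s - m + 1) - \<beta>"
  have c0: "0 < c1" "0 < c2" "1 \<le> D" unfolding c1_def c2_def D_def using m1 n1 by auto
  have m': "CARD('m) = Suc (CARD('m) - 1)" by simp
  have Nd: "N k * d k powr s = C * (real k ^ Suc CARD('m) * 2 powr (- \<gamma> * real k))" for k
  proof -
    have a: "real k ^ CARD('m) = real k ^ (CARD('m) - 1) * real k"
      by (subst m') (simp only: power_Suc mult.commute)
    have e: "real (CARD('m) - 1) = m - 1" by (simp add: m_def of_nat_diff Suc_leI)
    have alg: "- (c * (s - m + 1) - \<beta>) * x = (- c * x * s - - c * x * (m - 1)) + \<beta> * x" for c x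
      by (simp add: algebra_simps)
    have "2 powr (- \<gamma> * real k) = 2 powr (- (n / m) * real k * s - - (n / m) * real k * (m - 1)) * Y k"
      unfolding Y_def \<gamma>_def alg powr_add ..
    also have "2 powr (- (n / m) * real k * s - - (n / m) * real k * (m - 1)) = r k powr s / r k powr (m - 1)"
      unfolding r_def powr_powr by (rule powr_diff)
    also have "r k powr (m - 1) = r k ^ (CARD('m) - 1)"
      unfolding e[symmetric] by (rule powr_realpow[OF r0(1)])
    finally have b: "2 powr (- \<gamma> * real k) = r k powr s / r k ^ (CARD('m) - 1) * Y k" .
    show ?thesis
      unfolding power_Suc a b N_def d_def C_def using r0[of k] m1
      by (simp add: powr_mult power_mult_distrib power_divide)
  qed
  have s': "(m + n) / (n * (1 + w)) < s - m + 1" using s by linarith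
  have \<gamma>0: "0 < \<gamma>"
  proof -
    have "\<beta> = n / m * ((m + n) / (n * (1 + w)))" unfolding \<beta>_def using n1 by simp
    also have "\<dots> < n / m * (s - m + 1)" using s' m1 n1 by (intro mult_strict_left_mono) auto
    finally show ?thesis by (simp add: \<gamma>_def)
  qed
  show ?thesis
  proof (rule hausdorff_measure_limsup_eq_0[where E = E and N = N and d = d])
    have "0 < (m + n) / (n * (1 + w))" using m1 n1 w0 by simp
    then show "0 < s" using s m1 by linarith
    show "d \<longlonglongrightarrow> 0" unfolding d_def r_def using m1 n1 by real_asymp
    show "summable (\<lambda>k. N k * d k powr s)"
      unfolding Nd using \<gamma>0 by (intro summable_mult summable_power_times_exp)
    show "\<exists>\<^sub>\<infinity>k. b \<in> E k" if nb: "b \<in> - Bad_inf A" for b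
      unfolding INFM_nat_le
    proof
      fix K
      obtain c where c: "\<And>N. \<exists>q\<in>int_vecs. N \<le> infnorm q \<and>
          infnorm q powr (n / m) * dist_int (A *v q - b) \<le> c"
        using not_Bad_inf_frequently[of b A, folded n_def m_def] nb by auto
      \<comment> \<open>Taking \<open>q\<close> of size at least \<open>2 ^ j\<close> forces its
        dyadic scale \<open>k\<close> to be at least \<open>j\<close>, hence beyond
        \<open>K\<close>, \<open>c\<close> and \<open>infnorm b\<close>.\<close>
      define j where "j = Max {K, nat \<lceil>c\<rceil>, nat \<lceil>infnorm b\<rceil>}"
      have j: "K \<le> j" "c \<le> real j" "infnorm b \<le> real j"
        using real_nat_ceiling_ge[of c] real_nat_ceiling_ge[of "infnorm b"] by (auto simp: j_def)
      obtain q where q: "q \<in> int_vecs" "2 ^ j \<le> infnorm q"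
          "infnorm q powr (n / m) * dist_int (A *v q - b) \<le> c"
        using c by blast
      have "1 \<le> infnorm q" using q(2) one_le_power[of "2::real" j] by linarith
      then obtain k where k: "2 ^ k \<le> infnorm q" "infnorm q < 2 ^ Suc k"
        using exists_dyadic_scale by blast
      have "(2::real) ^ j < 2 ^ Suc k" using q(2) k(2) by linarith
      then have jk: "j \<le> k" by (metis less_Suc_eq_le one_less_numeral_iff power_less_imp_less_exp semiring_norm(76))
      then have "c \<le> real k" "infnorm b \<le> real k" using j by auto
      then have "b \<in> E k" unfolding E_def using q k by (auto intro!: bexI[of _ q])
      then show "\<exists>k\<ge>K. b \<in> E k" using j(1) jk by (meson order_trans)
    qed
    \<comment> \<open>The uniformity of the exponent enters here: a dual vector exists for every
      large \<open>k\<close> within the prescribed size \<open>Y k\<close>.\<close>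
    have "filterlim Y at_top sequentially" unfolding Y_def using \<beta>0 by real_asymp
    then have "\<forall>\<^sub>F k in sequentially. \<exists>y\<in>int_vecs.
        dist_int (transpose A *v y) < Y k powr (- w) \<and> 0 < infnorm y \<and> infnorm y < Y k"
      by (rule eventually_compose_filterlim[OF ev])
    then show "\<forall>\<^sub>F k in sequentially. \<exists>F. finite F \<and> real (card F) \<le> N k \<and> E k \<subseteq> \<Union>F \<and>
        (\<forall>U\<in>F. bounded U \<and> diameter U \<le> d k)"
      using eventually_ge_at_top[of 1]
    proof eventually_elim
      case (elim k)
      then obtain y where y: "y \<in> int_vecs" "dist_int (transpose A *v y) < Y k powr (- w)"
          "0 < infnorm y" "infnorm y < Y k" and k1: "1 \<le> k" by blast
      define L where "L = infnorm y"
      have L: "1 \<le> L" "L < Y k" using infnorm_int_vec_ge_1[OF y(1,3)] y(4) by (auto simp: L_def)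
      define V where "V = D * real k * (Y k * r k)"
      have V0: "0 \<le> V" unfolding V_def using c0 r0[of k] Y1[of k] by auto
      have sub: "E k \<subseteq> {b. infnorm b \<le> real k \<and> (\<exists>h\<in>\<int>. \<bar>y \<bullet> b - h\<bar> \<le> V)}"
      proof
        fix b assume "b \<in> E k"
        then obtain q where b: "infnorm b \<le> real k" and q: "q \<in> int_vecs" "2 ^ k \<le> infnorm q"
            "infnorm q < 2 ^ Suc k" "infnorm q powr (n / m) * dist_int (A *v q - b) \<le> real k"
          by (auto simp: E_def)
        have d0: "0 \<le> dist_int (A *v q - b)"
          using dist_int_attained[of "A *v q - b"] infnorm_pos_le by metis
        have "1 / r k = (2 ^ k) powr (n / m)"
          by (simp add: r_def powr_powr powr_minus_divide mult.commute flip: powr_realpow)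
        also have "\<dots> \<le> infnorm q powr (n / m)" using q(2) m1 n1 by (intro powr_mono2) auto
        finally have "1 / r k * dist_int (A *v q - b) \<le> infnorm q powr (n / m) * dist_int (A *v q - b)"
          using d0 by (intro mult_right_mono)
        then have "1 / r k * dist_int (A *v q - b) \<le> real k" using q(4) by linarith
        then have "dist_int (A *v q - b) \<le> real k * r k"
          using r0(1)[of k] by (simp add: pos_divide_le_eq)
        then obtain h where h: "h \<in> \<int>"
            "\<bar>y \<bullet> b - h\<bar> \<le> n * (Y k powr (- w) * 2 ^ Suc k) + m * (Y k * (real k * r k))"
          using slab_of_approximation[of q "2 ^ Suc k" y "Y k" A "Y k powr (- w)" b "real k * r k"] q y
          unfolding n_def m_def by (metis less_imp_le)
        have "n * (Y k powr (- w) * 2 ^ Suc k) = 2 * n * (2 ^ k * Y k powr (- w))" by simp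
        also have "\<dots> = 2 * n * 1 * (Y k * r k)" unfolding Yw by simp
        also have "\<dots> \<le> 2 * n * real k * (Y k * r k)"
          using k1 n1 r0[of k] Y1[of k] by (intro mult_right_mono mult_left_mono) auto
        finally have "\<bar>y \<bullet> b - h\<bar> \<le> V" using h(2) unfolding V_def D_def by (simp add: algebra_simps)
        then show "b \<in> {b. infnorm b \<le> real k \<and> (\<exists>h\<in>\<int>. \<bar>y \<bullet> b - h\<bar> \<le> V)}"
          using b h(1) by blast
      qed
      have V1: "V \<le> D * real k * L"
        unfolding V_def using Yr1[of k] L(1) c0 by (intro mult_left_mono) auto
      have kL: "1 * 1 \<le> real k * L" using k1 L by (intro mult_mono) auto
      have "1 * 1 \<le> real k * (1 / r k)" using k1 r0[of k] by (intro mult_mono) auto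
      then have kr: "1 \<le> real k / r k" by simp
      have "1 * 1 \<le> real k * (Y k / L)" using k1 L by (intro mult_mono) auto
      then have kY: "1 \<le> real k * Y k / L" by simp
      have bound: "(2 * (real k / r k + 1) + 1) ^ (CARD('m) - 1)
          * ((2 * ((V + m * (L * r k)) / (L * r k) + 1) + 1) * (2 * (m * (L * real k) + V) + 1)) \<le> N k"
      proof -
        define T H where "T = (V + m * (L * r k)) / (L * r k)" and "H = m * (L * real k) + V"
        have lin: "2 * (x + 1) + 1 \<le> 5 * x" if "1 \<le> x" for x :: real using that by simp
        have 1: "(2 * (real k / r k + 1) + 1) ^ (CARD('m) - 1) \<le> (5 * real k / r k) ^ (CARD('m) - 1)"
          using lin[OF kr] kr by (intro power_mono) auto
        have T: "T = D * (real k * Y k / L) + m"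
          unfolding T_def V_def using r0[of k] L by (simp add: field_simps)
        have 2: "2 * (T + 1) + 1 \<le> c1 * (real k * Y k / L)"
        proof -
          have "(2 * m + 3) * 1 \<le> (2 * m + 3) * (real k * Y k / L)"
            using kY m1 by (intro mult_left_mono) auto
          then show ?thesis unfolding T c1_def by (simp add: algebra_simps)
        qed
        have 3: "2 * H + 1 \<le> c2 * (real k * L)"
          using V1 kL unfolding H_def c2_def by (simp add: algebra_simps)
        have T0: "0 \<le> T" unfolding T using kY c0 m1 by (intro add_nonneg_nonneg mult_nonneg_nonneg) linarith+
        have H0: "0 \<le> H" unfolding H_def using V0 m1 L by auto
        have "(2 * (T + 1) + 1) * (2 * H + 1) \<le> (c1 * (real k * Y k / L)) * (c2 * (real k * L))"
          using 2 3 T0 H0 by (intro mult_mono) auto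
        also have "\<dots> = (c1 * real k * Y k) * (c2 * real k)" using L by simp
        finally have 4: "(2 * (T + 1) + 1) * (2 * H + 1) \<le> (c1 * real k * Y k) * (c2 * real k)" .
        show ?thesis unfolding N_def T_def[symmetric] H_def[symmetric]
          by (rule mult_mono[OF 1 4]) (use T0 H0 r0(1)[of k] in auto)
      qed
      show ?case unfolding d_def m_def
        by (intro slab_cover[where y = y and L = L and r = "r k" and R = "real k" and V = V] sub
              bound[unfolded m_def])
          (use L r0[of k] V0 L_def in auto)
    qed
  qed
qed

section \<open>Bounds by real numbers and the range of the uniform exponent\<close>

lemma ereal_le_if_le_above:
  fixes x y :: ereal
  assumes "\<And>s. y < ereal s \<Longrightarrow> x \<le> ereal s"
  shows "x \<le> y"
  using assms by (metis ereal_dense2 ereal_le_real le_cases not_le order.strict_implies_order)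

text \<open>The exponent 0 is admissible: rounding down puts every vector at distance less than 1
  from an integer vector, and a unit vector \<open>q\<close> is allowed once \<open>X > 1\<close>.
  Hence the denominator in the dimension bound is positive.\<close>

lemma unif_exponent_nonneg: "0 \<le> unif_exponent (B :: real ^ 'l ^ 'k)"
proof -
  obtain i :: 'l where True by simp
  have q: "axis i (1::real) \<in> int_vecs" by (auto simp: int_vecs_def axis_def)
  have i1: "infnorm (axis i (1::real)) = 1"
  proof (rule antisym)
    show "infnorm (axis i (1::real)) \<le> 1" by (rule infnorm_le_cart) (simp add: axis_def)
    show "1 \<le> infnorm (axis i (1::real))" using component_le_infnorm_cart[of "axis i (1::real)" i] by simp
  qed
  have lt1: "dist_int x < 1" for x :: "real ^ 'k"
  proof -
    define r :: "real ^ 'k" where "r = (\<chi> i. of_int \<lfloor>x $ i\<rfloor>)"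
    have "bdd_below ((\<lambda>q. infnorm (x - q)) ` int_vecs)"
      by (intro bdd_belowI[of _ 0]) (auto simp: infnorm_pos_le)
    then have "dist_int x \<le> infnorm (x - r)"
      unfolding dist_int_def by (intro cINF_lower) (auto simp: int_vecs_def r_def)
    also obtain i where "infnorm (x - r) = \<bar>(x - r) $ i\<bar>" using infnorm_attained by blast
    also have "\<bar>(x - r) $ i\<bar> < 1" by (simp add: r_def) linarith
    finally show ?thesis .
  qed
  have "\<forall>\<^sub>F X in at_top. \<exists>q\<in>int_vecs. dist_int (B *v q) < X powr (- 0) \<and> 0 < infnorm q \<and> infnorm q < X"
    using eventually_gt_at_top[of 1]
  proof eventually_elim
    case (elim X)
    then show ?case using lt1[of "B *v axis i 1"] q i1 by (intro bexI[of _ "axis i 1"]) auto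
  qed
  then show ?thesis unfolding unif_exponent_def
    by (intro Sup_upper) (auto simp: zero_ereal_def)
qed

subsection \<open>Transference\<close>

lemma dist_int_le:
  fixes x z :: "real ^ 'k"
  assumes "z \<in> int_vecs"
  shows "dist_int x \<le> infnorm (x - z)"
  unfolding dist_int_def using assms
  by (intro cINF_lower bdd_belowI[of _ 0]) (auto simp: infnorm_pos_le)

lemma of_int_floor_Ints: "x \<in> \<int> \<Longrightarrow> of_int \<lfloor>x :: real\<rfloor> = x"
  by (auto elim: Ints_cases)

text \<open>The exact invariant \<open>G\<close> and the intervals of length \<open>1 / K\<close>
  for the fractional parts are combined into one map with at most \<open>card T * K ^ card J\<close>
  values, so a single collision gives an equation and approximations at the same time.\<close>

lemma box_pigeonhole:
  fixes S :: "'a set" and G :: "'a \<Rightarrow> 'b" and f :: "'a \<Rightarrow> 'j \<Rightarrow> real"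
  assumes "finite S" and G: "G ` S \<subseteq> T" and "finite T" "finite J" and K: "0 < K"
    and card: "card T * K ^ card J < card S"
  shows "\<exists>x\<in>S. \<exists>y\<in>S. x \<noteq> y \<and> G x = G y \<and> (\<forall>j\<in>J. \<bar>frac (f x j) - frac (f y j)\<bar> < 1 / real K)"
proof -
  define F where "F x = (G x, restrict (\<lambda>j. \<lfloor>real K * frac (f x j)\<rfloor>) J)" for x
  define B where "B = T \<times> (PiE J (\<lambda>_. {0..<int K}))"
  have "finite B" unfolding B_def using assms by (intro finite_cartesian_product finite_PiE) auto
  have cB: "card B = card T * K ^ card J"
    unfolding B_def using assms by (simp add: card_cartesian_product card_PiE)
  have "F ` S \<subseteq> B"
  proof (rule image_subsetI)
    fix x assume "x \<in> S"
    have "real K * frac t < real K * 1" for t :: real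
      using K frac_lt_1[of t] by (intro mult_strict_left_mono) auto
    then have "0 \<le> \<lfloor>real K * frac t\<rfloor> \<and> \<lfloor>real K * frac t\<rfloor> < int K" for t :: real
      by (simp add: floor_less_iff)
    then show "F x \<in> B" using \<open>x \<in> S\<close> G unfolding F_def B_def by auto
  qed
  then have "card (F ` S) < card S"
    using card_mono[OF \<open>finite B\<close>, of "F ` S"] card cB by linarith
  then have "\<not> inj_on F S" by (rule pigeonhole)
  then obtain x y where xy: "x \<in> S" "y \<in> S" "x \<noteq> y" "F x = F y" unfolding inj_on_def by blast
  have "\<bar>frac (f x j) - frac (f y j)\<bar> < 1 / real K" if "j \<in> J" for j
  proof -
    have "restrict (\<lambda>j. \<lfloor>real K * frac (f x j)\<rfloor>) J j = restrict (\<lambda>j. \<lfloor>real K * frac (f y j)\<rfloor>) J j"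
      using xy(4) unfolding F_def by (metis prod.inject)
    then have "\<lfloor>real K * frac (f x j)\<rfloor> = \<lfloor>real K * frac (f y j)\<rfloor>" using that by simp
    then have "\<bar>real K * frac (f x j) - real K * frac (f y j)\<bar> < 1" by linarith
    then have "real K * \<bar>frac (f x j) - frac (f y j)\<bar> < 1"
      by (simp add: abs_mult flip: right_diff_distrib)
    then show ?thesis using K by (simp add: pos_less_divide_eq mult.commute)
  qed
  moreover have "G x = G y" using xy(4) unfolding F_def by simp
  ultimately show ?thesis using xy by blast
qed

text \<open>The sides may differ because \<open>transference_large_residual\<close> enlarges the
  range of one coordinate. Half-open ranges make the number of points exactly the product of the
  \<open>N i\<close>.\<close>

definition int_box :: "('k \<Rightarrow> nat) \<Rightarrow> (real ^ 'k) set" where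
  "int_box N = (\<lambda>c. \<chi> i. real_of_int (c i)) ` (PiE UNIV (\<lambda>i. {0..<int (N i)}))"

lemma finite_int_box: "finite (int_box N)"
  unfolding int_box_def by (intro finite_imageI finite_PiE) auto

lemma card_int_box: "card (int_box (N :: 'k::finite \<Rightarrow> nat)) = (\<Prod>i\<in>UNIV. N i)"
proof -
  have "inj_on (\<lambda>c. \<chi> i. real_of_int (c i)) (PiE (UNIV :: 'k set) (\<lambda>i. {0..<int (N i)}))"
    by (rule inj_onI) (auto simp: vec_eq_iff fun_eq_iff)
  then show ?thesis unfolding int_box_def by (simp add: card_image card_PiE)
qed

lemma int_box_diff:
  fixes x y :: "real ^ 'k"
  assumes "x \<in> int_box N" "y \<in> int_box N"
  shows "x - y \<in> int_vecs" and "\<bar>(x - y) $ i\<bar> \<le> real (N i)"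
proof -
  obtain c d where c: "c \<in> PiE UNIV (\<lambda>i. {0..<int (N i)})" "x = (\<chi> i. real_of_int (c i))"
    and d: "d \<in> PiE UNIV (\<lambda>i. {0..<int (N i)})" "y = (\<chi> i. real_of_int (d i))"
    using assms unfolding int_box_def by blast
  show "x - y \<in> int_vecs" using c d by (simp add: int_vecs_def)
  have "c i \<in> {0..<int (N i)}" "d i \<in> {0..<int (N i)}" using c d by auto
  then have "\<bar>c i - d i\<bar> \<le> int (N i)" by auto
  then show "\<bar>(x - y) $ i\<bar> \<le> real (N i)" using c d by simp
qed

lemma int_box_memD:
  fixes x :: "real ^ 'k"
  assumes "x \<in> int_box N"
  shows "x \<in> int_vecs" and "\<bar>x $ i\<bar> \<le> real (N i)"
proof -
  obtain c where c: "c \<in> PiE UNIV (\<lambda>i. {0..<int (N i)})" "x = (\<chi> i. real_of_int (c i))"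
    using assms unfolding int_box_def by blast
  show "x \<in> int_vecs" using c by (simp add: int_vecs_def)
  have "c i \<in> {0..<int (N i)}" using c by auto
  then show "\<bar>x $ i\<bar> \<le> real (N i)" using c by simp
qed

text \<open>Let \<open>j0\<close> be a coordinate with
  \<open>\<bar>q $ j0\<bar> = infnorm q = Q\<close>. Pigeonholing controls the other coordinates of
  \<open>\<eta>\<close> and fixes \<open>y \<bullet> p - fl y \<bullet> q\<close> modulo
  \<open>Q\<close>. The congruence allows a choice of \<open>z $ j0\<close> with
  \<open>y \<bullet> p = z \<bullet> q\<close>; the identity for \<open>\<eta> \<bullet> q\<close>,
  divided by \<open>Q\<close>, then bounds the coordinate \<open>j0\<close>.\<close>

lemma transference_small_residual:
  fixes A :: "real ^ 'n ^ 'm"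
  assumes q: "q \<in> int_vecs" "0 < infnorm q" and p: "p \<in> int_vecs"
    and K: "0 < K" and big: "infnorm q * real K ^ (CARD('n) - 1) < real P ^ CARD('m)"
  shows "\<exists>y\<in>int_vecs. y \<noteq> 0 \<and> infnorm y \<le> real P \<and> dist_int (transpose A *v y)
    \<le> real CARD('n) * (1 / real K) + real CARD('m) * (real P * infnorm (A *v q - p)) / infnorm q"
proof -
  define Q where "Q = infnorm q"
  define \<epsilon> where "\<epsilon> = infnorm (A *v q - p)"
  define B where "B = transpose A"
  obtain j0 where j0: "Q = \<bar>q $ j0\<bar>" unfolding Q_def using infnorm_attained by blast
  have "q $ j0 \<in> \<int>" using q by (simp add: int_vecs_def)
  then have "Q \<in> \<int>" unfolding j0 by simp
  then obtain h :: int where h: "Q = of_int h" by (auto elim: Ints_cases)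
  have Q0: "0 < Q" using q by (simp add: Q_def)
  then have h0: "0 < h" by (simp add: h)
  \<comment> \<open>The coordinate \<open>j0\<close> is left open here and filled later by
    \<open>u\<close>; this saves one factor \<open>K\<close> in the count.\<close>
  define fl where "fl y = (\<chi> j. if j = j0 then 0 else real_of_int \<lfloor>(B *v y) $ j\<rfloor>)" for y
  have fl: "fl y \<in> int_vecs" for y by (simp add: fl_def int_vecs_def)
  define G where "G y = \<lfloor>y \<bullet> p - fl y \<bullet> q\<rfloor> mod h" for y
  have "real (card {0..<h} * K ^ card (UNIV - {j0})) < real (card (int_box (\<lambda>_::'m. P)))"
    using big h0 h by (simp add: card_int_box card_Diff_singleton Q_def)
  then have card: "card {0..<h} * K ^ card (UNIV - {j0}) < card (int_box (\<lambda>_::'m. P))"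
    by (simp only: of_nat_less_iff)
  have GT: "G ` int_box (\<lambda>_. P) \<subseteq> {0..<h}" using h0 by (auto simp: G_def)
  obtain y1 y2 where y12: "y1 \<in> int_box (\<lambda>_. P)" "y2 \<in> int_box (\<lambda>_. P)" "y1 \<noteq> y2" "G y1 = G y2"
    and fr: "\<And>j. j \<noteq> j0 \<Longrightarrow> \<bar>frac ((B *v y1) $ j) - frac ((B *v y2) $ j)\<bar> < 1 / real K"
    using box_pigeonhole[OF finite_int_box GT _ _ K card, of "\<lambda>y j. (B *v y) $ j"] by auto
  define y where "y = y1 - y2"
  define z' where "z' = fl y1 - fl y2"
  have y: "y \<in> int_vecs" "y \<noteq> 0" "infnorm y \<le> real P"
    using int_box_diff[OF y12(1,2)] y12(3) unfolding y_def by (auto intro!: infnorm_le_cart)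
  have int: "of_int \<lfloor>y1 \<bullet> p - fl y1 \<bullet> q\<rfloor> = y1 \<bullet> p - fl y1 \<bullet> q" "of_int \<lfloor>y2 \<bullet> p - fl y2 \<bullet> q\<rfloor> = y2 \<bullet> p - fl y2 \<bullet> q"
    by (intro of_int_floor_Ints Ints_diff inner_int_vecs int_box_memD(1)[OF y12(1)]
          int_box_memD(1)[OF y12(2)] p q(1) fl)+
  have "h dvd \<lfloor>y1 \<bullet> p - fl y1 \<bullet> q\<rfloor> - \<lfloor>y2 \<bullet> p - fl y2 \<bullet> q\<rfloor>"
    using y12(4) unfolding G_def by (simp add: mod_eq_dvd_iff)
  then obtain t where "\<lfloor>y1 \<bullet> p - fl y1 \<bullet> q\<rfloor> - \<lfloor>y2 \<bullet> p - fl y2 \<bullet> q\<rfloor> = h * t" by (auto simp: dvd_def)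
  then have "real_of_int (\<lfloor>y1 \<bullet> p - fl y1 \<bullet> q\<rfloor> - \<lfloor>y2 \<bullet> p - fl y2 \<bullet> q\<rfloor>) = Q * of_int t"
    by (simp add: h)
  then have yp: "y \<bullet> p - z' \<bullet> q = Q * of_int t"
    unfolding y_def z'_def of_int_diff int by (simp add: inner_diff_left)
  \<comment> \<open>The sign turns a multiple of \<open>Q = \<bar>q $ j0\<bar>\<close> into a
    multiple of \<open>q $ j0\<close> itself.\<close>
  define u where "u = sgn (q $ j0) * of_int t"
  have u: "u \<in> \<int>" unfolding u_def by (auto simp: sgn_if)
  have uq: "u * q $ j0 = Q * of_int t" unfolding u_def j0 by (simp add: sgn_if abs_if)
  define z where "z = z' + axis j0 u"
  have z: "z \<in> int_vecs"
    using fl[of y1] fl[of y2] u unfolding z_def z'_def int_vecs_def by (auto simp: axis_def)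
  define \<eta> where "\<eta> = B *v y - z"
  have "z \<bullet> q = z' \<bullet> q + u * q $ j0"
    by (simp add: z_def inner_add_left inner_commute[of "axis j0 u"] inner_axis)
  then have "y \<bullet> p = z \<bullet> q" using yp uq by simp
  then have \<eta>q: "\<eta> \<bullet> q = y \<bullet> (A *v q - p)"
    by (simp add: \<eta>_def B_def inner_diff_left inner_diff_right inner_transpose)
  have small: "\<bar>\<eta> $ j\<bar> \<le> 1 / real K" if "j \<noteq> j0" for j
  proof -
    have "\<eta> $ j = frac ((B *v y1) $ j) - frac ((B *v y2) $ j)"
      using that by (simp add: \<eta>_def z_def z'_def fl_def y_def axis_def frac_def matrix_vector_mult_diff_distrib)
    then show ?thesis using fr[OF that] by simp
  qed
  \<comment> \<open>Removing the coordinate \<open>j0\<close> isolates the product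
    \<open>\<eta> $ j0 * q $ j0\<close>; all other coordinates of \<open>\<eta>\<close> are already
    small.\<close>
  define \<eta>' where "\<eta>' = \<eta> - axis j0 (\<eta> $ j0)"
  have "infnorm \<eta>' \<le> 1 / real K"
    using small by (intro infnorm_le_cart) (auto simp: \<eta>'_def axis_def)
  then have 1: "\<bar>\<eta>' \<bullet> q\<bar> \<le> real CARD('n) * (1 / real K * Q)"
    unfolding Q_def by (intro inner_le_card_infnorm) auto
  have 2: "\<bar>y \<bullet> (A *v q - p)\<bar> \<le> real CARD('m) * (real P * \<epsilon>)"
    unfolding \<epsilon>_def by (intro inner_le_card_infnorm y) auto
  have "\<eta>' \<bullet> q = \<eta> \<bullet> q - \<eta> $ j0 * q $ j0"
    by (simp add: \<eta>'_def inner_diff_left inner_commute[of "axis _ _"] inner_axis)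
  then have "\<bar>\<eta> $ j0 * q $ j0\<bar> \<le> real CARD('n) * (1 / real K * Q) + real CARD('m) * (real P * \<epsilon>)"
    using 1 2 \<eta>q by linarith
  then have "\<bar>\<eta> $ j0\<bar> \<le> (real CARD('n) * (1 / real K) * Q + real CARD('m) * (real P * \<epsilon>)) / Q"
    using Q0 by (simp add: abs_mult flip: j0) (simp add: pos_le_divide_eq)
  also have "\<dots> = real CARD('n) * (1 / real K) + real CARD('m) * (real P * \<epsilon>) / Q"
    using Q0 by (simp add: add_divide_distrib)
  finally have 3: "\<bar>\<eta> $ j0\<bar> \<le> real CARD('n) * (1 / real K) + real CARD('m) * (real P * \<epsilon>) / Q" .
  have "1 * (1 / real K) \<le> real CARD('n) * (1 / real K)"
    by (intro mult_right_mono) (auto simp: Suc_leI)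
  moreover have "0 \<le> real CARD('m) * (real P * \<epsilon>) / Q"
    using Q0 by (simp add: \<epsilon>_def infnorm_pos_le)
  ultimately have "1 / real K \<le> real CARD('n) * (1 / real K) + real CARD('m) * (real P * \<epsilon>) / Q"
    by linarith
  then have "infnorm \<eta> \<le> real CARD('n) * (1 / real K) + real CARD('m) * (real P * \<epsilon>) / Q"
    using 3 small by (intro infnorm_le_cart) (metis order_trans)
  then have "dist_int (B *v y) \<le> real CARD('n) * (1 / real K) + real CARD('m) * (real P * \<epsilon>) / Q"
    using dist_int_le[OF z, of "B *v y"] unfolding \<eta>_def by linarith
  then show ?thesis using y unfolding B_def Q_def \<epsilon>_def by blast
qed

text \<open>Here pigeonholing makes every coordinate of \<open>transpose A *v y - z\<close> small
  and gives \<open>y \<bullet> p = z \<bullet> q\<close> directly, at the price of a longer box in a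
  direction \<open>i0\<close> where the residual is largest. The identity then bounds
  \<open>y $ i0\<close> independently of that length.\<close>

lemma transference_large_residual:
  fixes A :: "real ^ 'n ^ 'm"
  assumes q: "q \<in> int_vecs" and p: "p \<in> int_vecs" and x0: "0 < infnorm (A *v q - p)"
    and K: "0 < K"
    and big: "(2 * real CARD('m) + 3) * infnorm (A *v q - p) * real K ^ CARD('n) < real P ^ (CARD('m) - 1)"
  shows "\<exists>y\<in>int_vecs. y \<noteq> 0 \<and> dist_int (transpose A *v y) \<le> 1 / real K \<and> infnorm y
    \<le> real CARD('m) * real P + real CARD('n) * (1 / real K * infnorm q) / infnorm (A *v q - p)"
proof -
  define Q where "Q = infnorm q"
  define \<xi> where "\<xi> = A *v q - p"
  define x where "x = infnorm \<xi>"
  have x: "0 < x" using x0 by (simp add: x_def \<xi>_def)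
  define B where "B = transpose A"
  define m n where "m = real CARD('m)" and "n = real CARD('n)"
  have m1: "1 \<le> m" unfolding m_def by (simp add: Suc_leI)
  have n1: "1 \<le> n" unfolding n_def by (simp add: Suc_leI)
  obtain i0 where i0: "x = \<bar>\<xi> $ i0\<bar>" unfolding x_def using infnorm_attained by blast
  define M where "M = max P (nat \<lceil>(n * Q + 1) / x\<rceil>)"
  have MP: "P \<le> M" by (simp add: M_def)
  have "(n * Q + 1) / x \<le> real M"
    using real_nat_ceiling_ge[of "(n * Q + 1) / x"] unfolding M_def by linarith
  then have Mx: "n * Q + 1 \<le> real M * x" using x by (simp add: pos_divide_le_eq)
  have Q0: "0 \<le> Q" by (simp add: Q_def infnorm_pos_le)
  then have nQ0: "0 \<le> n * Q" using n1 by simp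
  then have Mx1: "1 \<le> real M * x" using Mx by linarith
  then have M0: "0 < real M" using x by (metis mult_zero_left not_one_le_zero of_nat_0_less_iff of_nat_0 neq0_conv)
  \<comment> \<open>\<open>M\<close> is so large that the range of the integer \<open>y \<bullet> p - fl y \<bullet> q\<close> is proportional to \<open>M x\<close>;
    then \<open>M\<close> cancels in the pigeonhole count.\<close>
  define N where "N = (\<lambda>_. P)(i0 := M)"
  define H where "H = (m + 1) * (real M * x)"
  define fl where "fl y = (\<chi> j. real_of_int \<lfloor>(B *v y) $ j\<rfloor>)" for y
  have fl: "fl y \<in> int_vecs" for y by (simp add: fl_def int_vecs_def)
  have flB: "infnorm (B *v y - fl y) \<le> 1" for y
    by (rule infnorm_le_cart) (simp add: fl_def, linarith)
  have split: "y \<bullet> p - fl y \<bullet> q = (B *v y - fl y) \<bullet> q - y \<bullet> \<xi>" for y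
    by (simp add: \<xi>_def B_def inner_diff_left inner_diff_right inner_transpose)
  have int: "real_of_int \<lfloor>y \<bullet> p - fl y \<bullet> q\<rfloor> = y \<bullet> p - fl y \<bullet> q" if "y \<in> int_box N" for y
    by (intro of_int_floor_Ints Ints_diff inner_int_vecs int_box_memD(1)[OF that] p q fl)
  define G where "G y = \<lfloor>y \<bullet> p - fl y \<bullet> q\<rfloor>" for y
  define T where "T = {j::int. \<bar>real_of_int j\<bar> \<le> H}"
  have GT: "G ` int_box N \<subseteq> T"
  proof (rule image_subsetI)
    fix y assume y: "y \<in> int_box N"
    have "infnorm y \<le> real M"
    proof (rule infnorm_le_cart)
      fix i show "\<bar>y $ i\<bar> \<le> real M"
        using int_box_memD(2)[OF y, of i] MP by (auto simp: N_def split: if_splits)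
    qed
    then have "\<bar>y \<bullet> \<xi>\<bar> \<le> m * (real M * x)"
      unfolding m_def x_def by (intro inner_le_card_infnorm) auto
    moreover have "\<bar>(B *v y - fl y) \<bullet> q\<bar> \<le> n * (1 * Q)"
      unfolding n_def Q_def by (intro inner_le_card_infnorm flB) auto
    moreover have "H = m * (real M * x) + real M * x" by (simp add: H_def algebra_simps)
    ultimately have "\<bar>y \<bullet> p - fl y \<bullet> q\<bar> \<le> H" unfolding split using Mx by linarith
    then show "G y \<in> T" unfolding T_def G_def mem_Collect_eq int[OF y] .
  qed
  have H0: "0 \<le> H" unfolding H_def using m1 x by (intro mult_nonneg_nonneg) auto
  have "real (card T) \<le> 2 * H + 1" unfolding T_def by (rule card_int_interval[OF H0])
  \<comment> \<open>The inequality \<open>1 \<le> M * x\<close> absorbs the final 1, which yields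
    the constant \<open>2 * m + 3\<close> of the hypothesis.\<close>
  also have "\<dots> \<le> (2 * m + 3) * (real M * x)" unfolding H_def using Mx1 by (simp add: algebra_simps)
  finally have "real (card T) * real K ^ CARD('n) \<le> ((2 * m + 3) * (real M * x)) * real K ^ CARD('n)"
    by (intro mult_right_mono) auto
  also have "\<dots> = ((2 * m + 3) * x * real K ^ CARD('n)) * real M" by simp
  also have "\<dots> < real P ^ (CARD('m) - 1) * real M"
    using big M0 unfolding m_def x_def \<xi>_def by (intro mult_strict_right_mono) auto
  also have "\<dots> = real (card (int_box N))"
    unfolding card_int_box N_def by (subst prod.remove[of _ i0]) (auto simp: card_Diff_singleton mult.commute)
  finally have card: "card T * K ^ card (UNIV :: 'n set) < card (int_box N)"
    by (simp only: of_nat_less_iff flip: of_nat_power of_nat_mult)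
  have finT: "finite T" unfolding T_def by (rule finite_int_interval)
  obtain y1 y2 where y12: "y1 \<in> int_box N" "y2 \<in> int_box N" "y1 \<noteq> y2" "G y1 = G y2"
    and fr: "\<And>j. \<bar>frac ((B *v y1) $ j) - frac ((B *v y2) $ j)\<bar> < 1 / real K"
    using box_pigeonhole[OF finite_int_box GT finT _ K card, of "\<lambda>y j. (B *v y) $ j"] by auto
  define y where "y = y1 - y2"
  define z where "z = fl y1 - fl y2"
  define \<eta> where "\<eta> = B *v y - z"
  have y: "y \<in> int_vecs" "y \<noteq> 0"
    using int_box_diff(1)[OF y12(1,2)] y12(3) unfolding y_def by auto
  have yi: "\<bar>y $ i\<bar> \<le> real P" if "i \<noteq> i0" for i
    using int_box_diff(2)[OF y12(1,2), of i] that unfolding y_def N_def by simp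
  have z: "z \<in> int_vecs"
    using fl[of y1] fl[of y2] unfolding z_def int_vecs_def by auto
  have "\<bar>\<eta> $ j\<bar> \<le> 1 / real K" for j
  proof -
    have "\<eta> $ j = frac ((B *v y1) $ j) - frac ((B *v y2) $ j)"
      by (simp add: \<eta>_def z_def fl_def y_def frac_def matrix_vector_mult_diff_distrib)
    then show ?thesis using fr[of j] by simp
  qed
  then have \<eta>: "infnorm \<eta> \<le> 1 / real K" by (rule infnorm_le_cart)
  then have d: "dist_int (B *v y) \<le> 1 / real K"
    using dist_int_le[OF z, of "B *v y"] unfolding \<eta>_def by linarith
  have "y1 \<bullet> p - fl y1 \<bullet> q = of_int (G y1)" "y2 \<bullet> p - fl y2 \<bullet> q = of_int (G y2)"
    unfolding G_def by (rule int[OF y12(1), symmetric], rule int[OF y12(2), symmetric])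
  then have "y1 \<bullet> p - fl y1 \<bullet> q = y2 \<bullet> p - fl y2 \<bullet> q" unfolding y12(4) by linarith
  then have "y \<bullet> p = z \<bullet> q" unfolding y_def z_def inner_diff_left by linarith
  then have \<eta>q: "\<eta> \<bullet> q = y \<bullet> \<xi>"
    by (simp add: \<eta>_def B_def \<xi>_def inner_diff_left inner_diff_right inner_transpose)
  \<comment> \<open>The coordinate \<open>i0\<close>, so far bounded only by \<open>M\<close>, is
    isolated; the others are bounded by \<open>P\<close>.\<close>
  define y' where "y' = y - axis i0 (y $ i0)"
  have "infnorm y' \<le> real P"
    using yi by (intro infnorm_le_cart) (auto simp: y'_def axis_def)
  then have 1: "\<bar>y' \<bullet> \<xi>\<bar> \<le> m * (real P * x)"
    unfolding x_def m_def by (intro inner_le_card_infnorm) auto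
  have 2: "\<bar>\<eta> \<bullet> q\<bar> \<le> n * (1 / real K * Q)"
    unfolding n_def Q_def by (intro inner_le_card_infnorm \<eta>) auto
  have "y' \<bullet> \<xi> = y \<bullet> \<xi> - y $ i0 * \<xi> $ i0"
    by (simp add: y'_def inner_diff_left inner_commute[of "axis _ _"] inner_axis)
  then have "\<bar>y $ i0 * \<xi> $ i0\<bar> \<le> m * real P * x + n * (1 / real K * Q)"
    using 1 2 \<eta>q by (simp add: mult.assoc)
  then have "\<bar>y $ i0\<bar> \<le> (m * real P * x + n * (1 / real K * Q)) / x"
    using x by (simp add: abs_mult flip: i0) (simp add: pos_le_divide_eq)
  also have "\<dots> = m * real P + n * (1 / real K * Q) / x"
    using x by (simp add: add_divide_distrib)
  finally have 3: "\<bar>y $ i0\<bar> \<le> m * real P + n * (1 / real K * Q) / x" .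
  have "1 * real P \<le> m * real P" using m1 by (intro mult_right_mono) auto
  moreover have "0 \<le> n * (1 / real K * Q) / x" using x n1 Q0 by simp
  ultimately have "real P \<le> m * real P + n * (1 / real K * Q) / x" by linarith
  then have "infnorm y \<le> m * real P + n * (1 / real K * Q) / x"
    using 3 yi by (intro infnorm_le_cart) (metis order_trans)
  then show ?thesis using y d unfolding B_def Q_def m_def n_def x_def \<xi>_def by blast
qed

text \<open>The two cases meet at \<open>K * x * P = infnorm q\<close>: below it
  \<open>P * x / infnorm q \<le> 1 / K\<close>, above it \<open>infnorm q / (K * x) \<le> P\<close>.
  Either way the recovered coordinate obeys the bound already known for the others, up to a
  constant.\<close>

lemma transference:
  fixes A :: "real ^ 'n ^ 'm"
  assumes q: "q \<in> int_vecs" "0 < infnorm q" "infnorm q \<le> X" and d: "dist_int (A *v q) \<le> \<epsilon>"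
    and K: "0 < K" and big1: "X * real K ^ (CARD('n) - 1) < real P ^ CARD('m)"
    and big2: "(2 * real CARD('m) + 3) * \<epsilon> * real K ^ CARD('n) < real P ^ (CARD('m) - 1)"
  shows "\<exists>y\<in>int_vecs. 0 < infnorm y \<and> infnorm y \<le> (real CARD('m) + real CARD('n)) * real P \<and>
    dist_int (transpose A *v y) \<le> (real CARD('m) + real CARD('n)) / real K"
proof -
  obtain p where p: "p \<in> int_vecs" "dist_int (A *v q) = infnorm (A *v q - p)"
    using dist_int_attained by blast
  define x where "x = infnorm (A *v q - p)"
  have x\<epsilon>: "0 \<le> x" "x \<le> \<epsilon>" using d p by (auto simp: x_def infnorm_pos_le)
  have pos: "0 < infnorm y" if "y \<noteq> 0" for y :: "real ^ 'm" using that by (simp add: infnorm_pos_lt)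
  show ?thesis
  proof (cases "real K * x * real P \<le> infnorm q")
    case True
    have "infnorm q * real K ^ (CARD('n) - 1) \<le> X * real K ^ (CARD('n) - 1)"
      using q by (intro mult_right_mono) auto
    then have big: "infnorm q * real K ^ (CARD('n) - 1) < real P ^ CARD('m)" using big1 by linarith
    obtain y where y: "y \<in> int_vecs" "y \<noteq> 0" "infnorm y \<le> real P" "dist_int (transpose A *v y)
        \<le> real CARD('n) * (1 / real K) + real CARD('m) * (real P * x) / infnorm q"
      using transference_small_residual[OF q(1,2) p(1) K big, of A] unfolding x_def by blast
    have "real P * x / infnorm q \<le> 1 / real K"
      using True K q(2) by (simp add: divide_simps mult_ac)
    then have "real CARD('m) * (real P * x / infnorm q) \<le> real CARD('m) * (1 / real K)"
      by (intro mult_left_mono) auto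
    then have "dist_int (transpose A *v y) \<le> (real CARD('m) + real CARD('n)) / real K"
      using y(4) by (simp add: add_divide_distrib)
    moreover
    have "1 * real P \<le> (real CARD('m) + real CARD('n)) * real P"
      by (intro mult_right_mono) (auto simp: Suc_leI add_increasing2)
    then have "infnorm y \<le> (real CARD('m) + real CARD('n)) * real P" using y(3) by linarith
    ultimately show ?thesis using y(1) pos[OF y(2)] by blast
  next
    case False
    then have x0: "0 < x" using x\<epsilon>(1) q(2) by (cases "x = 0") auto
    have "(2 * real CARD('m) + 3) * x * real K ^ CARD('n) \<le> (2 * real CARD('m) + 3) * \<epsilon> * real K ^ CARD('n)"
      using x\<epsilon> by (intro mult_right_mono mult_left_mono) auto
    then have big: "(2 * real CARD('m) + 3) * x * real K ^ CARD('n) < real P ^ (CARD('m) - 1)"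
      using big2 by linarith
    obtain y where y: "y \<in> int_vecs" "y \<noteq> 0" "dist_int (transpose A *v y) \<le> 1 / real K" "infnorm y
        \<le> real CARD('m) * real P + real CARD('n) * (1 / real K * infnorm q) / x"
      using transference_large_residual[OF q(1) p(1) x0[unfolded x_def] K big[unfolded x_def]]
      unfolding x_def by blast
    have "1 / real K * infnorm q / x \<le> real P"
      using False K x0 by (simp add: divide_simps mult_ac)
    then have "real CARD('n) * (1 / real K * infnorm q / x) \<le> real CARD('n) * real P"
      by (intro mult_left_mono) auto
    then have "infnorm y \<le> (real CARD('m) + real CARD('n)) * real P"
      using y(4) by (simp add: distrib_right)
    moreover
    have "1 / real K \<le> (real CARD('m) + real CARD('n)) / real K"
      by (intro divide_right_mono) (auto simp: Suc_leI add_increasing2)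
    then have "dist_int (transpose A *v y) \<le> (real CARD('m) + real CARD('n)) / real K" using y(3) by linarith
    ultimately show ?thesis using y(1) pos[OF y(2)] by blast
  qed
qed

section \<open>From transference to uniform exponents\<close>

lemma eventually_powr_less:
  fixes \<alpha> \<beta> C :: real
  assumes "\<alpha> < \<beta>" "0 < C"
  shows "\<forall>\<^sub>F Z in at_top. C * Z powr \<alpha> < Z powr \<beta>"
  using assms by real_asymp

lemma unif_exponent_gtD:
  fixes B :: "real ^ 'l ^ 'k"
  assumes "ereal c < unif_exponent B"
  obtains w where "c < w" "\<forall>\<^sub>F X in at_top. \<exists>q\<in>int_vecs.
      dist_int (B *v q) < X powr (- w) \<and> 0 < infnorm q \<and> infnorm q < X"
  using assms unfolding unif_exponent_def less_Sup_iff by auto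

text \<open>\<open>transference\<close> is applied with \<open>X = Z powr a\<close>,
  \<open>K\<close> about \<open>Z powr b\<close> and \<open>P\<close> about \<open>Z / c\<close>.
  For \<open>a = b = m / n\<close> the exponents in its first size condition agree, and those in the
  second are strictly ordered exactly when \<open>w > n / m\<close>. This surplus pays for a small
  perturbation of \<open>a\<close> and \<open>b\<close>.\<close>

lemma very_singular_transpose_if:
  fixes A :: "real ^ 'n ^ 'm"
  assumes "very_singular A"
  shows "very_singular (transpose A)"
proof -
  define m n where "m = real CARD('m)" and "n = real CARD('n)"
  have m1: "1 \<le> m" and n1: "1 \<le> n" unfolding m_def n_def by (simp_all add: Suc_leI)
  obtain w where w: "n / m < w" and ev: "\<forall>\<^sub>F X in at_top. \<exists>q\<in>int_vecs.
      dist_int (A *v q) < X powr (- w) \<and> 0 < infnorm q \<and> infnorm q < X"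
    using unif_exponent_gtD assms unfolding very_singular_def m_def n_def by blast
  have "0 < n / m" using m1 n1 by simp
  then have w0: "0 < w" using w by linarith
  have wmn: "1 < w * m / n" using w m1 n1 by (simp add: field_simps)
  \<comment> \<open>This is half of the supremum of the perturbations allowed by
    \<open>n * b - a * w < m - 1\<close>.\<close>
  define \<delta> where "\<delta> = (w * m / n - 1) / (2 * n * (w + 1))"
  \<comment> \<open>Raising \<open>b\<close> by \<open>\<delta>\<close> lifts the dual exponent
    above \<open>m / n\<close>; lowering \<open>a\<close> by \<open>n * \<delta>\<close> leaves room
    \<open>\<delta>\<close> in the first size condition. The gap between \<open>w'\<close> and
    \<open>b\<close> absorbs the factor \<open>m + n\<close>.\<close>
  define a b w' where "a = m / n - n * \<delta>" and "b = m / n + \<delta>" and "w' = m / n + \<delta> / 2"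
  have \<delta>0: "0 < \<delta>" unfolding \<delta>_def using wmn w0 n1 by simp
  have "n * \<delta> * (w + 1) = (w * m / n - 1) / 2"
    unfolding \<delta>_def using w0 n1 by (simp add: divide_simps)
  then have nd: "n * \<delta> * (w + 1) < w * m / n - 1" using wmn by simp
  have aw: "1 + n * \<delta> < a * w"
    using nd unfolding a_def by (simp add: algebra_simps)
  have "0 < n * \<delta>" using n1 \<delta>0 by simp
  then have a0: "0 < a" using aw w0 by (metis add_pos_pos less_trans zero_less_mult_pos2 zero_less_one)
  have b0: "0 < b" unfolding b_def using m1 n1 \<delta>0 by (simp add: add_pos_pos)
  have en: "real (CARD('n) - 1) = n - 1" "real (CARD('m) - 1) = m - 1"
    by (simp_all add: m_def n_def of_nat_diff Suc_leI)
  have nb: "n * b = m + n * \<delta>" unfolding b_def using n1 by (simp add: distrib_left)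
  have exp1: "a + (n - 1) * b = m - \<delta>"
  proof -
    have "(n - 1) * b = n * b - b" by (simp add: left_diff_distrib)
    then show ?thesis using nb unfolding a_def b_def by linarith
  qed
  have exp2: "n * b - a * w < m - 1" using nb aw by linarith
  \<comment> \<open>With this divisor \<open>(m + n) * P\<close> is at most \<open>Z / 2\<close>,
    hence strictly below \<open>Z\<close>.\<close>
  define c where "c = 2 * (m + n)"
  have c0: "0 < c" unfolding c_def using m1 n1 by simp
  have "filterlim (\<lambda>Z. Z powr a) at_top at_top" using a0 by real_asymp
  then have ev1: "\<forall>\<^sub>F Z in at_top. \<exists>q\<in>int_vecs. dist_int (A *v q) < (Z powr a) powr (- w) \<and>
      0 < infnorm q \<and> infnorm q < Z powr a"
    by (rule eventually_compose_filterlim[OF ev])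
  \<comment> \<open>The constants here and in \<open>ev3\<close> allow for the divisor
    \<open>c\<close> and for the factors of 2 lost in rounding \<open>K\<close> up and
    \<open>P\<close> down.\<close>
  have ev2: "\<forall>\<^sub>F Z in at_top. 2 ^ (CARD('n) - 1) * (2 * c) ^ CARD('m) * Z powr (m - \<delta>) < Z powr m"
    using \<delta>0 c0 by (intro eventually_powr_less) auto
  have ev3: "\<forall>\<^sub>F Z in at_top. (2 * m + 3) * 2 ^ CARD('n) * (2 * c) ^ (CARD('m) - 1) * Z powr (n * b - a * w)
      < Z powr (m - 1)"
    using exp2 c0 m1 by (intro eventually_powr_less) auto
  have ev4: "\<forall>\<^sub>F Z in at_top. (m + n) * Z powr (- b) < Z powr (- w')"
    using \<delta>0 m1 n1 by (intro eventually_powr_less) (auto simp: b_def w'_def)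
  have "\<forall>\<^sub>F Z in at_top. \<exists>y\<in>int_vecs. dist_int (transpose A *v y) < Z powr (- w') \<and>
      0 < infnorm y \<and> infnorm y < Z"
    using ev1 ev2 ev3 ev4 eventually_ge_at_top[of 1] eventually_ge_at_top[of "2 * c"]
  proof eventually_elim
    case (elim Z)
    define P where "P = nat \<lfloor>Z / c\<rfloor>"
    define K where "K = nat \<lceil>Z powr b\<rceil>"
    have Zb: "1 \<le> Z powr b" using elim(5) b0 by (intro ge_one_powr_ge_zero) auto
    then have K: "Z powr b \<le> real K" "real K \<le> 2 * Z powr b" unfolding K_def by linarith+
    then have K0: "0 < K" using Zb by (cases K) auto
    have Zc: "2 \<le> Z / c" using elim(6) c0 by (simp add: pos_le_divide_eq)
    define t where "t = Z / c"
    have "real P \<le> t" "t \<le> 2 * real P" using Zc unfolding P_def t_def[symmetric] by linarith+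
    then have P: "real P \<le> Z / c" "Z / (2 * c) \<le> real P" unfolding t_def by simp_all
    obtain q where q: "q \<in> int_vecs" "dist_int (A *v q) < (Z powr a) powr (- w)"
        "0 < infnorm q" "infnorm q < Z powr a" using elim(1) by blast
    have Zm: "Z powr m = Z ^ CARD('m)" "Z powr (m - 1) = Z ^ (CARD('m) - 1)"
    proof -
      have "0 < Z" using elim(5) by simp
      then show "Z powr m = Z ^ CARD('m)" "Z powr (m - 1) = Z ^ (CARD('m) - 1)"
        unfolding en(2)[symmetric] unfolding m_def by (simp_all only: powr_realpow)
    qed
    have big1: "Z powr a * real K ^ (CARD('n) - 1) < real P ^ CARD('m)"
    proof -
      have "Z powr a * real K ^ (CARD('n) - 1) \<le> Z powr a * (2 * Z powr b) ^ (CARD('n) - 1)"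
        using K by (intro mult_left_mono power_mono) auto
      also have "\<dots> = 2 ^ (CARD('n) - 1) * Z powr (m - \<delta>)"
        using elim(5) unfolding exp1[symmetric] powr_add power_mult_distrib
        by (subst powr_power) (auto simp: n_def of_nat_diff)
      also have "\<dots> < (Z / (2 * c)) ^ CARD('m)"
        using elim(2) c0 unfolding Zm by (simp add: power_divide pos_less_divide_eq mult_ac)
      also have "\<dots> \<le> real P ^ CARD('m)"
        using P elim(5) c0 by (intro power_mono) auto
      finally show ?thesis .
    qed
    have big2: "(2 * m + 3) * (Z powr a) powr (- w) * real K ^ CARD('n) < real P ^ (CARD('m) - 1)"
    proof -
      have "(2 * m + 3) * (Z powr a) powr (- w) * real K ^ CARD('n)
          \<le> (2 * m + 3) * (Z powr a) powr (- w) * (2 * Z powr b) ^ CARD('n)"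
        using K m1 by (intro mult_left_mono power_mono) auto
      also have "(2 * Z powr b) ^ CARD('n) = 2 ^ CARD('n) * Z powr (n * b)"
        unfolding power_mult_distrib using elim(5) by (subst powr_power) (auto simp: n_def)
      also have "(2 * m + 3) * (Z powr a) powr (- w) * (2 ^ CARD('n) * Z powr (n * b))
          = (2 * m + 3) * 2 ^ CARD('n) * Z powr (n * b - a * w)"
        by (simp add: powr_powr powr_diff powr_minus_divide)
      also have "\<dots> < (Z / (2 * c)) ^ (CARD('m) - 1)"
        using elim(3) c0 unfolding Zm by (simp add: power_divide pos_less_divide_eq mult_ac)
      also have "\<dots> \<le> real P ^ (CARD('m) - 1)"
        using P elim(5) c0 by (intro power_mono) auto
      finally show ?thesis .
    qed
    obtain y where y: "y \<in> int_vecs" "0 < infnorm y" "infnorm y \<le> (m + n) * real P"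
        "dist_int (transpose A *v y) \<le> (m + n) / real K"
      using transference[OF q(1,3) less_imp_le[OF q(4)] less_imp_le[OF q(2)] K0 big1 big2[unfolded m_def]]
      unfolding m_def n_def by blast
    have "(m + n) * real P \<le> (m + n) * (Z / c)"
      using P m1 n1 by (intro mult_left_mono) auto
    also have "\<dots> = Z / 2" using c0 unfolding c_def by (simp add: field_simps)
    also have "\<dots> < Z" using elim(5) by simp
    finally have "infnorm y < Z" using y(3) by linarith
    moreover have "(m + n) / real K \<le> (m + n) / Z powr b"
      using K(1) K0 elim(5) m1 n1 by (intro divide_left_mono mult_pos_pos) auto
    then have "dist_int (transpose A *v y) < Z powr (- w')"
      using y(4) elim(4) by (simp add: powr_minus_divide)
    ultimately show ?case using y by blast
  qed
  then have "ereal w' \<le> unif_exponent (transpose A)"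
    unfolding unif_exponent_def by (intro Sup_upper) auto
  moreover have "ereal (m / n) < ereal w'" using \<delta>0 by (simp add: w'_def)
  ultimately show ?thesis unfolding very_singular_def m_def n_def by (rule less_le_trans[rotated])
qed

subsection \<open>The dimension bound\<close>

lemma hausdorff_dim_le_card:
  fixes S :: "(real ^ 'm) set"
  shows "hausdorff_dim S \<le> ereal (real CARD('m))"
proof (rule ereal_le_if_le_above)
  fix s assume "ereal (real CARD('m)) < ereal s"
  then show "hausdorff_dim S \<le> ereal s"
    by (intro hausdorff_dim_le hausdorff_measure_eq_0_above_dim)
      (auto intro: order_trans[OF of_nat_0_le_iff less_imp_le])
qed

text \<open>The condition on \<open>s\<close> is solved for the exponent, so that finite and
  infinite exponents are treated alike; being strict, it yields an admissible \<open>w\<close> even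
  if the supremum is not attained.\<close>

lemma hausdorff_dim_compl_Bad_inf_le:
  fixes A :: "real ^ 'n ^ 'm"
  defines "n \<equiv> real CARD('n)" and "m \<equiv> real CARD('m)"
  assumes u: "ereal (m / n) < unif_exponent (transpose A)"
    and s: "m - 1 < s" and su: "ereal ((m + n) / (n * (s - m + 1)) - 1) < unif_exponent (transpose A)"
  shows "hausdorff_dim (- Bad_inf A) \<le> ereal s"
proof -
  have m1: "1 \<le> m" and n1: "1 \<le> n" unfolding m_def n_def by (simp_all add: Suc_leI)
  have s0: "0 \<le> s" using s m1 by linarith
  define c where "c = max (m / n) ((m + n) / (n * (s - m + 1)) - 1)"
  have "ereal c < unif_exponent (transpose A)" using u su by (simp add: c_def max_def)
  then obtain w where w: "c < w" and ev: "\<forall>\<^sub>F X in at_top. \<exists>q\<in>int_vecs.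
      dist_int (transpose A *v q) < X powr (- w) \<and> 0 < infnorm q \<and> infnorm q < X"
    by (rule unif_exponent_gtD)
  have wmn: "m / n < w" and w2: "(m + n) / (n * (s - m + 1)) < 1 + w" using w by (auto simp: c_def)
  have "0 < m / n" using m1 n1 by simp
  then have w0: "0 < 1 + w" using wmn by linarith
  have t: "0 < s - m + 1" using s by simp
  have "m + n < (1 + w) * (n * (s - m + 1))"
    using w2 t n1 by (simp add: pos_divide_less_eq)
  then have "(m + n) / (n * (1 + w)) < s - m + 1"
    using w0 n1 by (simp add: pos_divide_less_eq mult_ac)
  then have "m - 1 + (m + n) / (n * (1 + w)) < s" by linarith
  then have "hausdorff_measure s (- Bad_inf A) = 0"
    using wmn unfolding m_def n_def by (intro hausdorff_measure_compl_Bad_inf_eq_0[OF ev]) auto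
  then show ?thesis by (rule hausdorff_dim_le[OF s0])
qed

theorem theorem1p6:
  fixes A :: "real ^ 'n ^ 'm"
  shows "hausdorff_dim (- Bad_inf A)
           \<le> ereal (real CARD('m))
             - (if unif_exponent (transpose A) = \<infinity> then 1
                else (unif_exponent (transpose A) - ereal (real CARD('m) / real CARD('n)))
                     / (unif_exponent (transpose A) + 1))
         \<and> (very_singular A \<longleftrightarrow> very_singular (transpose A))
         \<and> (very_singular A \<longrightarrow> hausdorff_dim (- Bad_inf A) < ereal (real CARD('m)))"
proof -
  define m n where "m = real CARD('m)" and "n = real CARD('n)"
  have m1: "1 \<le> m" and n1: "1 \<le> n" unfolding m_def n_def by (simp_all add: Suc_leI)
  define u where "u = unif_exponent (transpose A)"
  define R where "R = ereal m - (if u = \<infinity> then 1 else (u - ereal (m / n)) / (u + 1))"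
  have u0: "0 \<le> u" unfolding u_def by (rule unif_exponent_nonneg)
  have R_real: "R = ereal (m - (v - m / n) / (v + 1))" if "u = ereal v" for v
    using that u0 by (simp add: R_def flip: ereal_minus) (simp add: one_ereal_def)
  have key: "hausdorff_dim (- Bad_inf A) \<le> ereal s"
    if "ereal (m / n) < u" "m - 1 < s" "ereal ((m + n) / (n * (s - m + 1)) - 1) < u" for s
    using that unfolding m_def n_def u_def by (rule hausdorff_dim_compl_Bad_inf_le)
  have bound: "hausdorff_dim (- Bad_inf A) \<le> R"
  proof (cases "u = \<infinity>")
    case True
    \<comment> \<open>In the limit case every \<open>s > m - 1\<close> meets the conditions of
      \<open>key\<close>.\<close>
    have R: "R = ereal (m - 1)" using True by (simp add: R_def one_ereal_def)
    show ?thesis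
    proof (rule ereal_le_if_le_above)
      fix s assume "R < ereal s"
      then show "hausdorff_dim (- Bad_inf A) \<le> ereal s"
        unfolding R by (intro key) (auto simp: True)
    qed
  next
    case False
    then obtain v where v: "u = ereal v" using u0 by (cases u) auto
    have v0: "0 \<le> v" using u0 v by simp
    show ?thesis
    proof (cases "m / n < v")
      case True
      show ?thesis
      proof (rule ereal_le_if_le_above)
        fix s assume "R < ereal s"
        then have s: "m - (v - m / n) / (v + 1) < s" unfolding R_real[OF v] by simp
        \<comment> \<open>The distance of the bound from \<open>m - 1\<close> becomes
          \<open>(m + n) / n / (v + 1)\<close>, which can be solved for \<open>v\<close> as
          \<open>key\<close> requires.\<close>
        have "1 - (v - m / n) / (v + 1) = (1 + m / n) / (v + 1)"
          using v0 by (simp add: field_simps)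
        also have "1 + m / n = (m + n) / n" using n1 by (simp add: field_simps)
        finally have t: "(m + n) / n / (v + 1) < s - m + 1" using s by linarith
        have "0 < (m + n) / n / (v + 1)" using m1 n1 v0 by simp
        then have t0: "0 < s - m + 1" using t by linarith
        have "(m + n) / n < (s - m + 1) * (v + 1)"
          using v0 by (intro iffD1[OF pos_divide_less_eq t]) auto
        then have "(m + n) / n / (s - m + 1) < v + 1"
          by (intro iffD2[OF pos_divide_less_eq[OF t0]]) (simp add: mult.commute)
        then have "(m + n) / (n * (s - m + 1)) - 1 < v" by simp
        then show "hausdorff_dim (- Bad_inf A) \<le> ereal s"
          using True t0 by (intro key) (auto simp: v)
      qed
    next
      case False
      \<comment> \<open>For \<open>v \<le> m / n\<close> the claimed bound is at least
        \<open>m\<close>, so the trivial bound suffices.\<close>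
      then have "(v - m / n) / (v + 1) \<le> 0" using v0 by (simp add: divide_nonpos_pos)
      then have "ereal m \<le> R" unfolding R_real[OF v] by simp
      then show ?thesis using hausdorff_dim_le_card[of "- Bad_inf A"] unfolding m_def by simp
    qed
  qed
  have iff: "very_singular A \<longleftrightarrow> very_singular (transpose A)"
    using very_singular_transpose_if[of A] very_singular_transpose_if[of "transpose A"]
    by (auto simp: transpose_transpose)
  \<comment> \<open>Transposition turns the hypothesis into \<open>u > m / n\<close>, where the
    fraction subtracted in the bound is positive.\<close>
  have "R < ereal m" if "very_singular A"
  proof -
    have mu: "ereal (m / n) < u"
      using that iff unfolding very_singular_def u_def m_def n_def by simp
    show ?thesis
    proof (cases "u = \<infinity>")
      case True
      then show ?thesis by (simp add: R_def one_ereal_def)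
    next
      case False
      then obtain v where v: "u = ereal v" using u0 by (cases u) auto
      then have "0 < (v - m / n) / (v + 1)" using mu u0 by simp
      then show ?thesis unfolding R_real[OF v] by simp
    qed
  qed
  then show ?thesis using bound iff unfolding R_def u_def m_def n_def by (auto intro: le_less_trans)
qed

end
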